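(* For every integer $t\ge1$, the graph $M_t=H\sqcup K_t$ is disconnected and strongly nice. Moreover, $M_t$ is Schur positive if and only if $t=1$ or $t=2$. For every $t\ge3$, $$[s_{(3,3,3,1^{t-3})}]X_{M_t}=-4\,t!<0.$$
   Context: For a finite simple graph $G=(V,E)$, the chromatic symmetric function is $X_G=\sum_{\kappa}\prod_{v\in V}x_{\kappa(v)}$, where the sum ranges over all proper colorings $\kappa:V\to\mathbb N=\{1,2,\ldots\}$. It is a homogeneous symmetric function of degree $|V|$ in $x_1,x_2,\ldots$. Let $m_\lambda$ and $s_\lambda$ denote the monomial and Schur symmetric functions, and let $[b_\lambda]f$ be the coefficient of $b_\lambda$ in the expansion of $f$ in the basis $\{b_\lambda\}$. Write $X_G=\sum_{\lambda\vdash |V|}a_\lambda(G)m_\lambda$. For partitions $\lambda,\mu\vdash n$, $\lambda\ge\mu$ (dominance order) means $\sum_{i=1}^k\lambda_i\ge\sum_{i=1}^k\mu_i$ for every $k\ge1$ (parts beyond the length are $0$). Exponents in partitions denote repeated parts. $G$ is Schur positive if all coefficients of $X_G$ in the Schur basis are nonnegative. $G$ is strongly nice if $a_\lambda(G)\le a_\mu(G)$ for all $\lambda,\mu\vdash|V(G)|$ with $\lambda\ge\mu$. $H=K_{3,3}-e$ is the complete bipartite graph $K_{3,3}$ with one edge deleted, $K_t$ is the complete graph on $t$ vertices, and $\sqcup$ denotes disjoint union of graphs. *)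

theory Defs
  imports
    Graph_Theory.Kuratowski
    "HOL-Library.Multiset"
    "HOL-Library.FuncSet"
    "HOL-Library.Function_Algebras"
begin

section \<open>Graphs\<close>

text \<open>
  A finite simple graph is a symmetric loop-free \<open>pair_graph\<close> of the AFP entry Graph_Theory;
  an undirected edge is represented by its two arcs.
\<close>

definition complete_graph :: "nat \<Rightarrow> nat pair_pre_digraph" where
  "complete_graph t = \<lparr> pverts = {..<t}, parcs = {(u, v). u < t \<and> v < t \<and> u \<noteq> v} \<rparr>"

definition complete_bipartite_graph :: "nat \<Rightarrow> nat \<Rightarrow> (nat + nat) pair_pre_digraph" where
  "complete_bipartite_graph m n =
    \<lparr> pverts = {..<m} <+> {..<n},
      parcs = (Inl ` {..<m}) \<times> (Inr ` {..<n}) \<union> (Inr ` {..<n}) \<times> (Inl ` {..<m}) \<rparr>"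

definition del_edge :: "'a pair_pre_digraph \<Rightarrow> 'a \<Rightarrow> 'a \<Rightarrow> 'a pair_pre_digraph" where
  "del_edge G u v = \<lparr> pverts = pverts G, parcs = parcs G - {(u, v), (v, u)} \<rparr>"

definition disjoint_union ::
    "'a pair_pre_digraph \<Rightarrow> 'b pair_pre_digraph \<Rightarrow> ('a + 'b) pair_pre_digraph" (infixr \<open>\<squnion>\<^sub>G\<close> 65) where
  "G \<squnion>\<^sub>G H =
    \<lparr> pverts = pverts G <+> pverts H,
      parcs = map_prod Inl Inl ` parcs G \<union> map_prod Inr Inr ` parcs H \<rparr>"

text \<open>All edges of $K_{3,3}$ are equivalent under automorphisms, so a fixed one is deleted.\<close>

definition K33_minus_edge :: "(nat + nat) pair_pre_digraph" where
  "K33_minus_edge = del_edge (complete_bipartite_graph 3 3) (Inl 0) (Inr 0)"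

definition M_graph :: "nat \<Rightarrow> ((nat + nat) + nat) pair_pre_digraph" where
  "M_graph t = K33_minus_edge \<squnion>\<^sub>G complete_graph t"

lemma complete_graph_correct: "K\<^bsub>t\<^esub> (with_proj (complete_graph t))"
  unfolding complete_digraph_pair_def by (auto simp: complete_graph_def)

lemma complete_bipartite_graph_correct: "K\<^bsub>m,n\<^esub> (with_proj (complete_bipartite_graph m n))"
  unfolding complete_bipartite_digraph_pair_def
  by (rule conjI, simp add: complete_bipartite_graph_def,
      rule exI[of _ "Inl ` {..<m}"], rule exI[of _ "Inr ` {..<n}"])
     (auto simp: complete_bipartite_graph_def card_image Plus_def)

lemma edge_of_K33: "(Inl 0, Inr 0) \<in> parcs (complete_bipartite_graph 3 3)"
  by (auto simp: complete_bipartite_graph_def)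

lemma pair_graph_del_edge:
  assumes "pair_graph G" shows "pair_graph (del_edge G u v)"
proof -
  interpret pair_graph G by fact
  show ?thesis
    by unfold_locales
       (auto simp: del_edge_def symmetric_def sym_def wellformed' arcs_symmetric
             dest: no_loops' arcs_symmetric wellformed')
qed

lemma pair_graph_disjoint_union:
  assumes "pair_graph G" "pair_graph H" shows "pair_graph (G \<squnion>\<^sub>G H)"
proof -
  interpret G: pair_graph G by fact
  interpret H: pair_graph H by fact
  show ?thesis
    by unfold_locales
       (auto simp: disjoint_union_def symmetric_def sym_def
             dest: G.no_loops' H.no_loops' G.wellformed' H.wellformed'
             intro: G.arcs_symmetric H.arcs_symmetric)
qed

lemma pair_graph_M_graph: "pair_graph (M_graph t)"
  unfolding M_graph_def K33_minus_edge_def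
  by (intro pair_graph_disjoint_union pair_graph_del_edge
        pair_graphI_complete[OF complete_graph_correct]
        pair_graphI_complete_bipartite[OF complete_bipartite_graph_correct])


section \<open>Partitions\<close>

definition is_partition :: "nat list \<Rightarrow> bool" where
  "is_partition \<nu> \<longleftrightarrow> sorted_wrt (\<ge>) \<nu> \<and> 0 \<notin> set \<nu>"

definition partitions_of :: "nat \<Rightarrow> nat list set" where
  "partitions_of n = {\<nu>. is_partition \<nu> \<and> sum_list \<nu> = n}"

text \<open>Since \<open>take k\<close> stops at the end of a list, missing parts count as 0.\<close>

definition dominance_ge :: "nat list \<Rightarrow> nat list \<Rightarrow> bool" where
  "dominance_ge \<nu> \<mu> \<longleftrightarrow> (\<forall>k\<ge>1. sum_list (take k \<nu>) \<ge> sum_list (take k \<mu>))"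


section \<open>Symmetric functions\<close>

text \<open>
  A formal power series over the rationals in the variables $x_1, x_2, \dots$ is the function
  giving the coefficient of each monomial; the monomial $x^M$ is encoded by the multiset \<open>M\<close> in which
  the index $i$ occurs as often as the exponent of $x_i$. Index 0 is not a variable:
  all series below have coefficient 0 at multisets containing 0.
\<close>

type_synonym series = "nat multiset \<Rightarrow> rat"

definition series_scale :: "rat \<Rightarrow> series \<Rightarrow> series" where
  "series_scale c f = (\<lambda>M. c * f M)"

interpretation series: vector_space series_scale
  by unfold_locales (auto simp: series_scale_def fun_eq_iff algebra_simps)

text \<open>The sum of all distinct monomials whose nonzero exponents are the parts of \<open>\<nu>\<close>.\<close>

definition monomial_sym :: "nat list \<Rightarrow> series" where
  "monomial_sym \<nu> M =
    (if set_mset M \<subseteq> {1..} \<and> image_mset (count M) (mset_set (set_mset M)) = mset \<nu> then 1 else 0)"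

definition cells :: "nat list \<Rightarrow> (nat \<times> nat) set" where
  "cells \<nu> = {(i, j). i < length \<nu> \<and> j < \<nu> ! i}"

definition SSYT :: "nat list \<Rightarrow> (nat \<times> nat \<Rightarrow> nat) set" where
  "SSYT \<nu> = {T \<in> cells \<nu> \<rightarrow>\<^sub>E {1..}.
     (\<forall>i j. (i, j) \<in> cells \<nu> \<and> (i, Suc j) \<in> cells \<nu> \<longrightarrow> T (i, j) \<le> T (i, Suc j)) \<and>
     (\<forall>i j. (i, j) \<in> cells \<nu> \<and> (Suc i, j) \<in> cells \<nu> \<longrightarrow> T (i, j) < T (Suc i, j))}"

text \<open>
  $s_\nu = \sum_T \prod_c x_{T(c)}$ over semistandard tableaux \<open>T\<close> of shape \<open>\<nu>\<close>,
  with the monomials collected: the coefficient of $x^M$ is the (finite) number of \<open>T\<close>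
  whose multiset of entries is \<open>M\<close>.
\<close>

definition schur :: "nat list \<Rightarrow> series" where
  "schur \<nu> M = of_nat (card {T \<in> SSYT \<nu>. image_mset T (mset_set (cells \<nu>)) = M})"

definition proper_colorings :: "'a pair_pre_digraph \<Rightarrow> ('a \<Rightarrow> nat) set" where
  "proper_colorings G =
    {\<kappa> \<in> pverts G \<rightarrow>\<^sub>E {1..}. \<forall>(u, v) \<in> parcs G. \<kappa> u \<noteq> \<kappa> v}"

text \<open>$X_G = \sum_\kappa \prod_v x_{\kappa(v)}$, with the monomials collected likewise.\<close>

definition chromatic_sym :: "'a pair_pre_digraph \<Rightarrow> series" where
  "chromatic_sym G M =
    of_nat (card {\<kappa> \<in> proper_colorings G. image_mset \<kappa> (mset_set (pverts G)) = M})"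

text \<open>
  The coefficient $[b_\nu] f$ in the expansion of \<open>f\<close> in the basis
  $\{b_\mu\}$ of the space of symmetric functions, where $\mu$ ranges over all partitions.
  \<open>series.representation\<close> is the library's coordinate function; by its convention it is 0
  if the $b_\mu$ are linearly dependent or \<open>f\<close> is not in their span.
\<close>

definition basis_coeff :: "(nat list \<Rightarrow> series) \<Rightarrow> nat list \<Rightarrow> series \<Rightarrow> rat" where
  "basis_coeff b \<nu> f = series.representation (b ` Collect is_partition) f (b \<nu>)"

definition strongly_nice :: "'a pair_pre_digraph \<Rightarrow> bool" where
  "strongly_nice G \<longleftrightarrow>
    (\<forall>\<nu> \<in> partitions_of (card (pverts G)). \<forall>\<mu> \<in> partitions_of (card (pverts G)).
       dominance_ge \<nu> \<mu> \<longrightarrow>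
       basis_coeff monomial_sym \<nu> (chromatic_sym G) \<le> basis_coeff monomial_sym \<mu> (chromatic_sym G))"

definition schur_positive :: "'a pair_pre_digraph \<Rightarrow> bool" where
  "schur_positive G \<longleftrightarrow> (\<forall>\<nu>. is_partition \<nu> \<longrightarrow> basis_coeff schur \<nu> (chromatic_sym G) \<ge> 0)"

end

theory Submission
  imports Defs "HOL-Library.More_List" "HOL-Combinatorics.Transposition"
begin

text \<open>
  Since $X_{K_t} = t!\, e_t$ and $X$ is multiplicative on disjoint unions,
  $X_{M_t} = t!\, e_t X_H$. The claims about the Schur and monomial coefficients of $X_{M_t}$ thus become
  claims about the one symmetric function $X_H$ of degree 6 and about multiplication by $e_t$.

  Schur coefficients. Here
  $X_H = 2 s_{33} + 4 s_{321} + 2 s_{3111} - 4 s_{222} + 26 s_{2211} + 52 s_{21111} + 152 s_{111111}$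
  (\<open>chromatic_sym_H_schur\<close>), and by the Pieri rule $e_t s_\lambda$ is the sum of the
  $s_\nu$ for which $\nu/\lambda$ is a vertical strip of size $t$ (\<open>pieri_schur\<close>). The shape
  $(3,3,3,1^{t-3})$ arises only from $222$, because each of the other six shapes lacks two or more
  cells in one of the first three rows; this gives the coefficient $-4\, t!$. If $t$ is 1 or 2,
  then every shape that arises from $222$ arises also from $321$ or from $2211$, whose coefficients
  $4$ and $26$ compensate for the $-4$.

  Strong niceness. The number $a_\lambda(G)$ is the coefficient of $x^\lambda$ in $X_G$, and
  dominance is generated by moves of one unit from a larger exponent to one that is smaller by at
  least two. The coefficients of $X_H$ do not decrease under such moves
  (\<open>transfer_monotone_H\<close>, a finite check), and multiplication by $e_t$ preserves this property of a
  symmetric function with nonnegative coefficients (\<open>transfer_monotone_e_mult\<close>).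

  Two tools connect these arguments with the definitions. The monomial and the Schur functions are
  triangular with respect to dominance, so that any finite expansion that has been found yields the
  basis coefficients (\<open>basis_coeff_triangular\<close>). Semistandard tableaux and proper
  colorings both obey a recursion that removes all occurrences of one colour
  (\<open>tableaux_branching\<close>, \<open>colorings_branching\<close>). The first of these reduces the Pieri rule,
  by induction on the number of variables, to a count of the shapes between two given ones; together
  they make the two sides of the expansion of $X_H$ computable, and it is enough to compare them on
  the 32 compositions of 6.
\<close>


section \<open>Coefficients in a triangular basis\<close>

text \<open>
  The monomial $x_1^{\nu_1} x_2^{\nu_2} \cdots$. Part \<open>i\<close> of a list is the exponent of the variable with
  index \<open>Suc i\<close>, since the index 0 is not a variable.
\<close>

definition canon :: "nat list \<Rightarrow> nat multiset" where
  "canon \<nu> = (\<Sum>i<length \<nu>. replicate_mset (\<nu> ! i) (Suc i))"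

text \<open>
  Partitions as functions with value 0 beyond the last row: strips can then be described row by row
  without a comparison of lengths.
\<close>

abbreviation shape :: "nat list \<Rightarrow> nat \<Rightarrow> nat" where
  "shape \<equiv> nth_default 0"

lemma count_canon_0 [simp]: "count (canon \<nu>) 0 = 0"
  by (simp add: canon_def count_sum)

lemma count_canon_Suc [simp]: "count (canon \<nu>) (Suc i) = shape \<nu> i"
proof -
  have "count (canon \<nu>) (Suc i) = (\<Sum>j<length \<nu>. if j = i then \<nu> ! i else 0)"
    unfolding canon_def count_sum by (rule sum.cong) auto
  then show ?thesis by (simp add: nth_default_def sum.delta')
qed

lemma set_canon: "set_mset (canon \<nu>) \<subseteq> Suc ` {..<length \<nu>}"
proof
  fix x assume "x \<in># canon \<nu>"
  then have "count (canon \<nu>) x \<noteq> 0" by simp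
  then show "x \<in> Suc ` {..<length \<nu>}"
    by (cases x) (auto simp: nth_default_def simp del: count_eq_zero_iff split: if_splits)
qed

lemma size_canon [simp]: "size (canon \<nu>) = sum_list \<nu>"
  by (simp add: canon_def sum_list_sum_nth atLeast0LessThan)

lemma sum_list_take_shape: "sum_list (take k \<nu>) = (\<Sum>i<k. shape \<nu> i)"
  by (induction k) (auto simp: nth_default_def take_Suc_conv_app_nth not_less)

lemma dominance_ge_iff:
  "dominance_ge \<nu> \<mu> \<longleftrightarrow> (\<forall>k. (\<Sum>i<k. shape \<mu> i) \<le> (\<Sum>i<k. shape \<nu> i))"
  unfolding dominance_ge_def sum_list_take_shape
  by (metis One_nat_def lessThan_0 less_one not_le sum.empty zero_le)

lemma partition_eqI:
  assumes "is_partition \<nu>" "is_partition \<mu>" "shape \<nu> = shape \<mu>"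
  shows "\<nu> = \<mu>"
proof (rule nth_equalityI)
  have pos: "i < length \<xi> \<longleftrightarrow> shape \<xi> i \<noteq> 0" if "is_partition \<xi>" for \<xi> i
  proof -
    have "i < length \<xi> \<Longrightarrow> \<xi> ! i \<noteq> 0" using that unfolding is_partition_def by (metis nth_mem)
    then show ?thesis by (simp add: nth_default_def)
  qed
  have *: "i < length \<nu> \<longleftrightarrow> i < length \<mu>" for i
    using pos assms by simp
  then show len: "length \<nu> = length \<mu>" by (meson linorder_neqE_nat less_irrefl)
  show "\<nu> ! i = \<mu> ! i" if "i < length \<nu>" for i
    using fun_cong[OF assms(3), of i] that len by (simp add: nth_default_def)
qed

lemma dominance_antisym:
  assumes "is_partition \<nu>" "is_partition \<mu>" "dominance_ge \<nu> \<mu>" "dominance_ge \<mu> \<nu>"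
  shows "\<nu> = \<mu>"
proof (rule partition_eqI[OF assms(1,2)])
  have e: "(\<Sum>i<k. shape \<mu> i) = (\<Sum>i<k. shape \<nu> i)" for k
    using assms(3,4) by (auto simp: dominance_ge_iff intro: antisym)
  show "shape \<nu> = shape \<mu>"
  proof
    fix i show "shape \<nu> i = shape \<mu> i" using e[of i] e[of "Suc i"] by simp
  qed
qed

lemma dominance_trans: "dominance_ge a b \<Longrightarrow> dominance_ge b c \<Longrightarrow> dominance_ge a c"
  unfolding dominance_ge_def by (meson order_trans)

lemma sum_series_apply: "(\<Sum>x\<in>A. F x) (M :: nat multiset) = (\<Sum>x\<in>A. F x M :: rat)"
  by (induction A rule: infinite_finite_induct) auto

text \<open>
  A family that is triangular for dominance, with nonzero diagonal, is injective and linearly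
  independent: in a vanishing combination take a dominance-maximal index \<open>\<mu>\<close> among the nonzero terms
  and look at the monomial \<open>canon \<mu>\<close>, in which only the term of \<open>\<mu>\<close> occurs. Hence the
  coordinates of \<open>f\<close> are the coefficients of any expansion of \<open>f\<close>.
\<close>

lemma basis_coeff_triangular:
  fixes b :: "nat list \<Rightarrow> series"
  assumes tri: "\<And>\<nu> \<mu>. is_partition \<nu> \<Longrightarrow> is_partition \<mu> \<Longrightarrow> b \<nu> (canon \<mu>) \<noteq> 0 \<Longrightarrow> dominance_ge \<nu> \<mu>"
    and diag: "\<And>\<nu>. is_partition \<nu> \<Longrightarrow> b \<nu> (canon \<nu>) \<noteq> 0"
    and A: "finite A" "A \<subseteq> Collect is_partition"
    and f: "\<And>M. f M = (\<Sum>\<nu>\<in>A. c \<nu> * b \<nu> M)"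
    and \<nu>: "is_partition \<nu>"
  shows "basis_coeff b \<nu> f = (if \<nu> \<in> A then c \<nu> else 0)"
proof -
  let ?P = "Collect is_partition"
  have inj: "inj_on b ?P"
    by (rule inj_onI) (metis diag dominance_antisym mem_Collect_eq tri)
  have ind: "series.independent (b ` ?P)"
    unfolding series.dependent_explicit
  proof safe
    fix S u v
    assume S: "finite S" "S \<subseteq> b ` ?P" "v \<in> S" "u v \<noteq> 0"
      and 0: "(\<Sum>w\<in>S. series_scale (u w) w) = 0"
    obtain D where D: "D \<subseteq> ?P" "S = b ` D" using S(2) by (auto simp: subset_image_iff)
    have injD: "inj_on b D" using inj D by (blast intro: inj_on_subset)
    have finD: "finite D" using S(1) D injD by (simp add: finite_image_iff)
    define E where "E = {\<xi> \<in> D. u (b \<xi>) \<noteq> 0}"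
    have E: "finite E" "E \<noteq> {}" using finD S(3,4) D by (auto simp: E_def)
    define R where "R \<xi> \<eta> = (dominance_ge \<eta> \<xi> \<and> \<eta> \<noteq> \<xi>)" for \<xi> \<eta>
    have EP: "\<xi> \<in> E \<Longrightarrow> is_partition \<xi>" for \<xi> using D by (auto simp: E_def)
    have "asymp_on E R"
      by (rule asymp_onI) (auto simp: R_def dest: dominance_antisym EP)
    moreover have "transp_on E R"
      by (rule transp_onI) (use dominance_antisym EP dominance_trans in \<open>unfold R_def, blast\<close>)
    ultimately obtain \<mu> where \<mu>: "\<mu> \<in> E" "\<And>\<xi>. \<xi> \<in> E \<Longrightarrow> \<xi> \<noteq> \<mu> \<Longrightarrow> \<not> R \<mu> \<xi>"
      using E Finite_Set.bex_max_element[of E R] by blast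
    have "0 = (\<Sum>w\<in>S. series_scale (u w) w) (canon \<mu>)" by (simp add: 0)
    also have "\<dots> = (\<Sum>\<xi>\<in>D. u (b \<xi>) * b \<xi> (canon \<mu>))"
      unfolding sum_series_apply D(2) sum.reindex[OF injD] by (simp add: series_scale_def)
    also have "\<dots> = (\<Sum>\<xi>\<in>D. if \<xi> = \<mu> then u (b \<mu>) * b \<mu> (canon \<mu>) else 0)"
    proof (rule sum.cong[OF refl])
      fix \<xi> assume \<xi>: "\<xi> \<in> D"
      show "u (b \<xi>) * b \<xi> (canon \<mu>) = (if \<xi> = \<mu> then u (b \<mu>) * b \<mu> (canon \<mu>) else 0)"
        using \<mu>(2)[of \<xi>] tri[of \<xi> \<mu>] \<xi> D(1) EP[OF \<mu>(1)] by (auto simp: E_def R_def)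
    qed
    also have "\<dots> = u (b \<mu>) * b \<mu> (canon \<mu>)"
      using \<mu>(1) finD by (simp add: E_def)
    finally show False using diag[OF EP[OF \<mu>(1)]] \<mu>(1) by (auto simp: E_def)
  qed
  have f': "f = (\<Sum>\<mu>\<in>A. series_scale (c \<mu>) (b \<mu>))"
    by (rule ext) (simp add: f sum_series_apply series_scale_def)
  have mem: "b \<mu> \<in> b ` ?P" if "\<mu> \<in> A" for \<mu> using that A by auto
  have sp: "series_scale (c \<mu>) (b \<mu>) \<in> series.span (b ` ?P)" if "\<mu> \<in> A" for \<mu>
    using series.span_scale[OF series.span_base[OF mem[OF that]]] .
  have "series.representation (b ` ?P) f (b \<nu>) =
      (\<Sum>\<mu>\<in>A. c \<mu> * (if b \<nu> = b \<mu> then 1 else 0))"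
    unfolding f'
    by (subst series.representation_sum[OF ind])
       (auto intro!: sum.cong sp simp: series.representation_scale[OF ind series.span_base[OF mem]]
            series.representation_basis[OF ind mem])
  also have "\<dots> = (\<Sum>\<mu>\<in>A. if \<mu> = \<nu> then c \<nu> else 0)"
  proof (rule sum.cong[OF refl])
    fix \<mu> assume "\<mu> \<in> A"
    then have "b \<nu> = b \<mu> \<longleftrightarrow> \<mu> = \<nu>" using inj_on_eq_iff[OF inj, of \<nu> \<mu>] \<nu> A by auto
    then show "c \<mu> * (if b \<nu> = b \<mu> then 1 else 0) = (if \<mu> = \<nu> then c \<nu> else 0)" by auto
  qed
  also have "\<dots> = (if \<nu> \<in> A then c \<nu> else 0)" using A by simp
  finally show ?thesis by (simp add: basis_coeff_def)
qed

section \<open>Tableaux and the branching rule\<close>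

definition young :: "(nat \<Rightarrow> nat) \<Rightarrow> (nat \<times> nat) set" where
  "young \<alpha> = {(i, j). j < \<alpha> i}"

definition ptn :: "(nat \<Rightarrow> nat) \<Rightarrow> bool" where
  "ptn \<alpha> \<longleftrightarrow> antimono \<alpha> \<and> finite {i. \<alpha> i \<noteq> 0}"

text \<open>
  Semistandard tableaux of a given shape and content; the counterpart of \<open>SSYT\<close> for shapes that are
  functions.
\<close>

definition tableaux :: "(nat \<Rightarrow> nat) \<Rightarrow> nat multiset \<Rightarrow> (nat \<times> nat \<Rightarrow> nat) set" where
  "tableaux \<alpha> M = {T \<in> young \<alpha> \<rightarrow>\<^sub>E {1..}.
     (\<forall>i j. Suc j < \<alpha> i \<longrightarrow> T (i, j) \<le> T (i, Suc j)) \<and>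
     (\<forall>i j. j < \<alpha> i \<and> j < \<alpha> (Suc i) \<longrightarrow> T (i, j) < T (Suc i, j)) \<and>
     image_mset T (mset_set (young \<alpha>)) = M}"

text \<open>
  The skew shape \<open>\<alpha>/\<sigma>\<close> is a horizontal strip: the rows interlace.
\<close>

definition hstrip :: "(nat \<Rightarrow> nat) \<Rightarrow> (nat \<Rightarrow> nat) \<Rightarrow> bool" where
  "hstrip \<alpha> \<sigma> \<longleftrightarrow> (\<forall>i. \<sigma> i \<le> \<alpha> i \<and> \<alpha> (Suc i) \<le> \<sigma> i)"

lemma mem_young [simp]: "(i, j) \<in> young \<alpha> \<longleftrightarrow> j < \<alpha> i"
  by (simp add: young_def)

lemma young_inject: "young \<alpha> = young \<sigma> \<longleftrightarrow> \<alpha> = \<sigma>"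
proof
  assume eq: "young \<alpha> = young \<sigma>"
  show "\<alpha> = \<sigma>"
  proof
    fix i
    have "j < \<alpha> i \<longleftrightarrow> j < \<sigma> i" for j using eq mem_young[of i j] by metis
    then show "\<alpha> i = \<sigma> i" by (meson linorder_neqE_nat less_irrefl)
  qed
qed simp

lemma young_mono: "young \<sigma> \<subseteq> young \<alpha> \<longleftrightarrow> (\<forall>i. \<sigma> i \<le> \<alpha> i)"
  by (auto simp: young_def subset_iff) (meson not_less less_irrefl order_less_le_trans)+

lemma finite_young: "ptn \<alpha> \<Longrightarrow> finite (young \<alpha>)"
proof -
  assume "ptn \<alpha>"
  moreover have "young \<alpha> = (SIGMA i:{i. \<alpha> i \<noteq> 0}. {..<\<alpha> i})" by (auto simp: young_def)
  ultimately show ?thesis by (simp add: ptn_def)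
qed

lemma hstrip_ptn: "ptn \<alpha> \<Longrightarrow> hstrip \<alpha> \<sigma> \<Longrightarrow> ptn \<sigma>"
proof -
  assume "ptn \<alpha>" and h: "hstrip \<alpha> \<sigma>"
  have "\<sigma> (Suc i) \<le> \<sigma> i" for i using h unfolding hstrip_def by (metis order_trans)
  then have "antimono \<sigma>" by (rule decseq_SucI)
  moreover have "{i. \<sigma> i \<noteq> 0} \<subseteq> {i. \<alpha> i \<noteq> 0}" using h unfolding hstrip_def by (auto simp: subset_iff intro: order_less_le_trans)
  ultimately show "ptn \<sigma>" using \<open>ptn \<alpha>\<close> finite_subset unfolding ptn_def by blast
qed

lemma finite_hstrips: "ptn \<alpha> \<Longrightarrow> finite {\<sigma>. hstrip \<alpha> \<sigma>}"
proof -
  assume "ptn \<alpha>"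
  then have "finite (Pow (young \<alpha>))" by (simp add: finite_young)
  moreover have "young ` {\<sigma>. hstrip \<alpha> \<sigma>} \<subseteq> Pow (young \<alpha>)"
    by (auto simp: hstrip_def young_def intro: order_less_le_trans)
  ultimately have "finite (young ` {\<sigma>. hstrip \<alpha> \<sigma>})" by (rule finite_subset[rotated])
  then show ?thesis by (rule finite_imageD) (auto simp: inj_on_def young_inject)
qed

lemma finite_tableaux:
  assumes "ptn \<alpha>" shows "finite (tableaux \<alpha> M)"
proof (rule finite_subset)
  show "tableaux \<alpha> M \<subseteq> young \<alpha> \<rightarrow>\<^sub>E set_mset M"
    using finite_young[OF assms] by (auto simp: tableaux_def PiE_iff extensional_def)
  show "finite (young \<alpha> \<rightarrow>\<^sub>E set_mset M)" by (intro finite_PiE finite_young[OF assms]) simp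
qed

lemma tableaux_size: "T \<in> tableaux \<alpha> M \<Longrightarrow> size M = card (young \<alpha>)"
  by (auto simp: tableaux_def)

lemma tableaux_pos: "ptn \<alpha> \<Longrightarrow> T \<in> tableaux \<alpha> M \<Longrightarrow> 0 \<notin># M"
  using finite_young[of \<alpha>] by (fastforce simp: tableaux_def PiE_iff)

lemma tableaux_row_mono:
  assumes T: "T \<in> tableaux \<alpha> M" and "j \<le> j'" "j' < \<alpha> i"
  shows "T (i, j) \<le> T (i, j')"
  using assms(2,3)
proof (induction j' rule: dec_induct)
  case (step m)
  then show ?case using T by (auto simp: tableaux_def intro: order_trans)
qed simp

lemma split_off_largest:
  assumes "\<And>x. x \<in># A \<Longrightarrow> x < n" "\<And>x. x \<in># M \<Longrightarrow> x < (n :: nat)"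
    and eq: "A + replicate_mset a n = M + replicate_mset k n"
  shows "A = M \<and> a = k"
proof -
  have "count A n = 0" "count M n = 0" using assms(1,2) by (auto simp: count_eq_zero_iff)
  then have "a = k" using arg_cong[OF eq, of "\<lambda>X. count X n"] by simp
  then show ?thesis using eq by simp
qed

lemma card_young_diff:
  "ptn \<alpha> \<Longrightarrow> hstrip \<alpha> \<sigma> \<Longrightarrow> card (young \<sigma>) + card (young \<alpha> - young \<sigma>) = card (young \<alpha>)"
  by (metis card_Diff_subset card_mono finite_young hstrip_def hstrip_ptn le_add_diff_inverse young_mono)

text \<open>
  Deleting the cells with the largest entry \<open>n\<close> is inverse to filling the strip \<open>\<alpha>/\<sigma>\<close>
  with \<open>n\<close>. The filled columns stay strict because a horizontal strip has at most one cell in each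
  column.
\<close>

lemma card_tableaux_restrict:
  assumes \<alpha>: "ptn \<alpha>" and h: "hstrip \<alpha> \<sigma>" and k: "card (young \<sigma>) + k = card (young \<alpha>)"
    and M: "\<And>x. x \<in># M \<Longrightarrow> x < n" and n: "n \<ge> 1"
  defines "F \<equiv> {T \<in> tableaux \<alpha> (M + replicate_mset k n). {c \<in> young \<alpha>. T c < n} = young \<sigma>}"
  shows "card F = card (tableaux \<sigma> M)"
proof -
  let ?Y = "young \<alpha>" and ?Z = "young \<sigma>"
  have fin: "finite ?Y" "finite ?Z" using finite_young \<alpha> hstrip_ptn[OF \<alpha> h] by auto
  have sub: "?Z \<subseteq> ?Y" using h by (simp add: young_mono hstrip_def)
  have kc: "card (?Y - ?Z) = k" using card_young_diff[OF \<alpha> h] k by simp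
  have le1: "\<sigma> i \<le> \<alpha> i" and le2: "\<alpha> (Suc i) \<le> \<sigma> i" for i using h by (auto simp: hstrip_def)
  have Yms: "mset_set ?Y = mset_set ?Z + mset_set (?Y - ?Z)"
    using fin sub by (metis Diff_disjoint Un_Diff_cancel finite_Diff mset_set_Union sup.absorb_iff2)
  have const: "image_mset T (mset_set (?Y - ?Z)) = replicate_mset k n"
    if "\<And>c. c \<in> ?Y - ?Z \<Longrightarrow> T c = n" for T :: "nat \<times> nat \<Rightarrow> nat"
    using that fin kc by (subst image_mset_cong[where g = "\<lambda>_. n"]) (auto simp: image_mset_const_eq)
  \<comment> \<open>Fill the strip with the largest entry.\<close>
  define ext where "ext T = (\<lambda>c. if c \<in> ?Z then T c else if c \<in> ?Y then n else undefined)"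
    for T :: "nat \<times> nat \<Rightarrow> nat"
  have "bij_betw (\<lambda>T. restrict T ?Z) F (tableaux \<sigma> M)"
  proof (rule bij_betw_byWitness[where f' = ext])
    have top: "T c = n" if "T \<in> F" "c \<in> ?Y - ?Z" for T c
    proof -
      have "T c \<in># image_mset T (mset_set ?Y)" using that fin by auto
      moreover have "image_mset T (mset_set ?Y) = M + replicate_mset k n"
        using that by (simp add: F_def tableaux_def)
      ultimately have "T c \<in># M + replicate_mset k n" by (simp only:)
      then have "T c \<le> n" using M[of "T c"] by (auto split: if_splits)
      moreover have "\<not> T c < n" using that by (auto simp: F_def)
      ultimately show ?thesis by simp
    qed
    show "\<forall>T\<in>F. ext (restrict T ?Z) = T"
    proof
      fix T assume T: "T \<in> F"
      then have "T \<in> extensional ?Y" by (simp add: F_def tableaux_def PiE_iff)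
      then show "ext (restrict T ?Z) = T"
        using top[OF T] sub by (auto simp: ext_def fun_eq_iff extensional_def)
    qed
    show "\<forall>T\<in>tableaux \<sigma> M. restrict (ext T) ?Z = T"
      by (auto simp: ext_def fun_eq_iff tableaux_def PiE_iff extensional_def restrict_def)
    show "(\<lambda>T. restrict T ?Z) ` F \<subseteq> tableaux \<sigma> M"
    proof safe
      fix T assume T: "T \<in> F"
      have c: "image_mset T (mset_set ?Z) + replicate_mset k n = M + replicate_mset k n"
        using T const[OF top[OF T]] Yms by (auto simp: F_def tableaux_def)
      have "image_mset (restrict T ?Z) (mset_set ?Z) = image_mset T (mset_set ?Z)"
        using fin by (intro image_mset_cong) auto
      then have "image_mset (restrict T ?Z) (mset_set ?Z) = M" using c by simp
      moreover have "j < \<sigma> i \<Longrightarrow> j < \<alpha> i" for i j using le1[of i] by simp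
      ultimately show "restrict T ?Z \<in> tableaux \<sigma> M"
        using T sub by (auto simp: F_def tableaux_def PiE_iff)
    qed
    show "ext ` tableaux \<sigma> M \<subseteq> F"
    proof safe
      fix T assume T: "T \<in> tableaux \<sigma> M"
      have lt: "T c < n" if "c \<in> ?Z" for c
      proof -
        have "T c \<in># image_mset T (mset_set ?Z)" using that fin by auto
        then show ?thesis using T M by (auto simp: tableaux_def)
      qed
      have e1: "ext T c = T c" if "c \<in> ?Z" for c using that by (simp add: ext_def)
      have e2: "ext T c = n" if "c \<in> ?Y - ?Z" for c using that by (simp add: ext_def)
      have "image_mset (ext T) (mset_set ?Z) = image_mset T (mset_set ?Z)"
        using fin by (intro image_mset_cong) (auto simp: ext_def)
      then have cont: "image_mset (ext T) (mset_set ?Y) = M + replicate_mset k n"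
        using const[of "ext T", OF e2] Yms T by (simp add: tableaux_def)
      have row: "ext T (i, j) \<le> ext T (i, Suc j)" if "Suc j < \<alpha> i" for i j
      proof (cases "Suc j < \<sigma> i")
        case True then show ?thesis using T by (simp add: ext_def tableaux_def)
      next
        case False
        then have "ext T (i, Suc j) = n" using that by (simp add: ext_def)
        moreover have "ext T (i, j) \<le> n" using lt[of "(i, j)"] that by (auto simp: ext_def)
        ultimately show ?thesis by simp
      qed
      have col: "ext T (i, j) < ext T (Suc i, j)" if "j < \<alpha> (Suc i)" for i j
      proof -
        have j: "j < \<sigma> i" using that le2[of i] by simp
        show ?thesis
        proof (cases "j < \<sigma> (Suc i)")
          case True then show ?thesis using T j by (simp add: ext_def tableaux_def)
        next
          case False then show ?thesis using lt[of "(i, j)"] j that by (simp add: ext_def)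
        qed
      qed
      have "j < \<sigma> i \<Longrightarrow> j < \<alpha> i" for i j using le1[of i] by simp
      then have mem: "ext T \<in> ?Y \<rightarrow>\<^sub>E {1..}"
        using T n by (auto simp: ext_def tableaux_def PiE_iff extensional_def)
      have "{c \<in> ?Y. ext T c < n} = ?Z" using lt sub by (auto simp: ext_def)
      then show "ext T \<in> F" using cont row col mem unfolding F_def tableaux_def by blast
    qed
  qed
  then show ?thesis by (rule bij_betw_same_card)
qed

text \<open>
  The cells with entries below \<open>n\<close> form a shape since rows increase weakly, and the remaining cells form
  a horizontal strip since columns increase strictly.
\<close>

lemma tableaux_branching:
  assumes \<alpha>: "ptn \<alpha>" and M: "\<And>x. x \<in># M \<Longrightarrow> x < n" and n: "n \<ge> 1"
  shows "card (tableaux \<alpha> (M + replicate_mset k n)) =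
    (\<Sum>\<sigma> | hstrip \<alpha> \<sigma> \<and> card (young \<sigma>) + k = card (young \<alpha>). card (tableaux \<sigma> M))"
proof -
  let ?N = "M + replicate_mset k n"
  define H where "H = {\<sigma>. hstrip \<alpha> \<sigma> \<and> card (young \<sigma>) + k = card (young \<alpha>)}"
  define F where "F \<sigma> = {T \<in> tableaux \<alpha> ?N. {c \<in> young \<alpha>. T c < n} = young \<sigma>}" for \<sigma>
  have finH: "finite H" using finite_hstrips[OF \<alpha>] by (simp add: H_def)
  have "tableaux \<alpha> ?N = (\<Union>\<sigma>\<in>H. F \<sigma>)"
  proof (rule equalityI)
    show "tableaux \<alpha> ?N \<subseteq> (\<Union>\<sigma>\<in>H. F \<sigma>)"
    proof
      fix T assume T: "T \<in> tableaux \<alpha> ?N"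
      have le_n: "T c \<le> n" if "c \<in> young \<alpha>" for c
      proof -
        have "T c \<in># image_mset T (mset_set (young \<alpha>))" using that finite_young[OF \<alpha>] by auto
        moreover have "image_mset T (mset_set (young \<alpha>)) = ?N" using T by (simp add: tableaux_def)
        ultimately have "T c \<in># ?N" by (simp only:)
        then show ?thesis using M[of "T c"] by (auto split: if_splits)
      qed
      \<comment> \<open>The number of entries below \<open>n\<close> in row \<open>i\<close>, as the first column whose entry is not below \<open>n\<close>.\<close>
      define \<sigma> where "\<sigma> i = (LEAST j. \<alpha> i \<le> j \<or> n \<le> T (i, j))" for i
      have \<sigma>1: "\<alpha> i \<le> \<sigma> i \<or> n \<le> T (i, \<sigma> i)" for i
        unfolding \<sigma>_def by (rule LeastI[of _ "\<alpha> i"]) simp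
      have \<sigma>2: "\<sigma> i \<le> \<alpha> i" for i unfolding \<sigma>_def by (rule Least_le) simp
      have \<sigma>3: "j < \<sigma> i \<longleftrightarrow> j < \<alpha> i \<and> T (i, j) < n" for i j
      proof
        assume "j < \<sigma> i"
        then show "j < \<alpha> i \<and> T (i, j) < n" unfolding \<sigma>_def by (auto dest: not_less_Least)
      next
        assume j: "j < \<alpha> i \<and> T (i, j) < n"
        show "j < \<sigma> i"
        proof (rule ccontr)
          assume "\<not> j < \<sigma> i"
          then have "T (i, \<sigma> i) \<le> T (i, j)" using j by (intro tableaux_row_mono[OF T]) auto
          then show False using \<sigma>1[of i] j \<open>\<not> j < \<sigma> i\<close> by auto
        qed
      qed
      have eq: "{c \<in> young \<alpha>. T c < n} = young \<sigma>" using \<sigma>3 by (auto simp: young_def)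
      have h: "hstrip \<alpha> \<sigma>"
        unfolding hstrip_def
      proof (intro allI conjI \<sigma>2)
        fix i
        show "\<alpha> (Suc i) \<le> \<sigma> i"
        proof (rule ccontr)
          assume *: "\<not> \<alpha> (Suc i) \<le> \<sigma> i"
          have "\<alpha> (Suc i) \<le> \<alpha> i" using \<alpha> by (auto simp: ptn_def antimono_def)
          then have "n \<le> T (i, \<sigma> i)" "T (i, \<sigma> i) < T (Suc i, \<sigma> i)"
            using * \<sigma>1[of i] T by (auto simp: tableaux_def)
          then show False using le_n[of "(Suc i, \<sigma> i)"] * by simp
        qed
      qed
      have fin: "finite (young \<alpha>)" "finite (young \<sigma>)" using finite_young \<alpha> hstrip_ptn[OF \<alpha> h] by auto
      have "mset_set (young \<alpha>) = mset_set (young \<sigma>) + mset_set (young \<alpha> - young \<sigma>)"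
        using fin h
        by (metis Diff_disjoint Un_Diff_cancel finite_Diff mset_set_Union sup.absorb_iff2 young_mono hstrip_def)
      moreover have "image_mset T (mset_set (young \<alpha> - young \<sigma>)) = replicate_mset (card (young \<alpha> - young \<sigma>)) n"
      proof -
        have "T c = n" if "c \<in> young \<alpha> - young \<sigma>" for c
          using that le_n[of c] eq by (metis (mono_tags, lifting) DiffE mem_Collect_eq order_le_less)
        then show ?thesis
          using fin by (subst image_mset_cong[where g = "\<lambda>_. n"]) (auto simp: image_mset_const_eq)
      qed
      ultimately have "image_mset T (mset_set (young \<sigma>)) + replicate_mset (card (young \<alpha> - young \<sigma>)) n = ?N"
        using T by (simp add: tableaux_def)
      then have "card (young \<alpha> - young \<sigma>) = k"
        using split_off_largest[of "image_mset T (mset_set (young \<sigma>))" n M] M fin eq by auto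
      then have "\<sigma> \<in> H" using h card_young_diff[OF \<alpha> h] by (simp add: H_def)
      then show "T \<in> (\<Union>\<sigma>\<in>H. F \<sigma>)" using T eq by (auto simp: F_def)
    qed
  qed (auto simp: F_def)
  then have "card (tableaux \<alpha> ?N) = card (\<Union>\<sigma>\<in>H. F \<sigma>)" by simp
  also have "\<dots> = (\<Sum>\<sigma>\<in>H. card (F \<sigma>))"
    using finH finite_tableaux[OF \<alpha>, of ?N]
    by (intro card_UN_disjoint) (auto simp: F_def young_inject)
  also have "\<dots> = (\<Sum>\<sigma>\<in>H. card (tableaux \<sigma> M))"
    using card_tableaux_restrict[OF \<alpha> _ _ M n] by (intro sum.cong) (auto simp: H_def F_def)
  finally show ?thesis by (simp add: H_def)
qed

section \<open>The Pieri rule for elementary symmetric functions\<close>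

abbreviation kostka :: "(nat \<Rightarrow> nat) \<Rightarrow> nat multiset \<Rightarrow> nat" where
  "kostka \<alpha> M \<equiv> card (tableaux \<alpha> M)"

definition add_cells :: "(nat \<Rightarrow> nat) \<Rightarrow> nat set \<Rightarrow> nat \<Rightarrow> nat" where
  "add_cells \<alpha> S i = \<alpha> i + of_bool (i \<in> S)"

text \<open>
  A vertical strip on \<open>\<alpha>\<close> has at most one cell in each row, and so is given by the set of rows that receive
  a cell.
\<close>

definition vstrips :: "(nat \<Rightarrow> nat) \<Rightarrow> nat \<Rightarrow> nat set set" where
  "vstrips \<alpha> t = {S. finite S \<and> card S = t \<and> antimono (add_cells \<alpha> S)}"

text \<open>
  The coefficients of the product of $e_t$ and \<open>f\<close>: a set \<open>S\<close> stands for the squarefree monomial taken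
  from $e_t$. The type of coefficients is left open since the operator acts both on series and on counts
  of tableaux or colorings.
\<close>

definition e_mult :: "nat \<Rightarrow> (nat multiset \<Rightarrow> 'a :: comm_monoid_add) \<Rightarrow> nat multiset \<Rightarrow> 'a" where
  "e_mult t f M = (\<Sum>S | S \<subseteq> set_mset M - {0} \<and> card S = t. f (M - mset_set S))"

lemma ptn_add_cells: "ptn \<alpha> \<Longrightarrow> finite S \<Longrightarrow> antimono (add_cells \<alpha> S) \<Longrightarrow> ptn (add_cells \<alpha> S)"
proof -
  assume a: "ptn \<alpha>" "finite S" "antimono (add_cells \<alpha> S)"
  have "{i. add_cells \<alpha> S i \<noteq> 0} \<subseteq> {i. \<alpha> i \<noteq> 0} \<union> S" by (auto simp: add_cells_def)
  then show ?thesis using a finite_subset unfolding ptn_def by blast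
qed

lemma card_young_add_cells:
  assumes "ptn \<alpha>" "finite S"
  shows "card (young (add_cells \<alpha> S)) = card (young \<alpha>) + card S"
proof -
  have "young (add_cells \<alpha> S) = young \<alpha> \<union> (\<lambda>i. (i, \<alpha> i)) ` S"
    by (auto simp: young_def add_cells_def of_bool_def split: if_splits)
  moreover have "card ((\<lambda>i. (i, \<alpha> i)) ` S) = card S" by (rule card_image) (auto intro: inj_onI)
  moreover have "young \<alpha> \<inter> (\<lambda>i. (i, \<alpha> i)) ` S = {}" by auto
  ultimately show ?thesis using assms finite_young by (simp add: card_Un_disjoint)
qed

text \<open>
  A strip that reaches an empty row has a cell in each empty row above it, so it reaches at most \<open>t\<close> empty
  rows.
\<close>

lemma finite_vstrips:
  assumes "ptn \<alpha>" shows "finite (vstrips \<alpha> t)"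
proof -
  obtain N where N: "\<And>i. \<alpha> i \<noteq> 0 \<Longrightarrow> i < N"
    using assms unfolding ptn_def finite_nat_set_iff_bounded by auto
  have "S \<subseteq> {..<N + t}" if S: "S \<in> vstrips \<alpha> t" for S
  proof
    fix i assume i: "i \<in> S"
    show "i \<in> {..<N + t}"
    proof (rule ccontr)
      assume "i \<notin> {..<N + t}"
      \<comment> \<open>A cell in row \<open>i\<close> forces one in each of these empty rows, which are more than \<open>t\<close> in all.\<close>
      have "{N..i} \<subseteq> S"
      proof
        fix j assume j: "j \<in> {N..i}"
        have "add_cells \<alpha> S i \<le> add_cells \<alpha> S j" using S j by (auto simp: vstrips_def antimono_def)
        then show "j \<in> S" using i N[of j] j by (auto simp: add_cells_def of_bool_def split: if_splits)
      qed
      then have "card {N..i} \<le> card S" using S by (intro card_mono) (auto simp: vstrips_def)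
      then show False using \<open>i \<notin> _\<close> S by (auto simp: vstrips_def)
    qed
  qed
  then have "vstrips \<alpha> t \<subseteq> Pow {..<N + t}" by blast
  then show ?thesis by (rule finite_subset) simp
qed

lemma card_between:
  assumes D: "finite D" "A \<subseteq> D"
  shows "card {S. A \<subseteq> S \<and> S \<subseteq> D \<and> card S = m} =
    (if card A \<le> m then (card D - card A) choose (m - card A) else 0)"
proof (cases "card A \<le> m")
  case True
  have fA: "finite A" using D finite_subset by blast
  have "bij_betw (\<lambda>S. S - A) {S. A \<subseteq> S \<and> S \<subseteq> D \<and> card S = m} {S. S \<subseteq> D - A \<and> card S = m - card A}"
  proof (rule bij_betw_byWitness[where f' = "\<lambda>S. S \<union> A"])
    show "(\<lambda>S. S - A) ` {S. A \<subseteq> S \<and> S \<subseteq> D \<and> card S = m} \<subseteq> {S. S \<subseteq> D - A \<and> card S = m - card A}"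
      using fA by (auto simp: card_Diff_subset)
    show "(\<lambda>S. S \<union> A) ` {S. S \<subseteq> D - A \<and> card S = m - card A} \<subseteq> {S. A \<subseteq> S \<and> S \<subseteq> D \<and> card S = m}"
    proof safe
      fix S assume S: "S \<subseteq> D - A" "card S = m - card A"
      have "finite S" using S D by (meson finite_Diff finite_subset)
      moreover have "S \<inter> A = {}" using S by auto
      ultimately show "card (S \<union> A) = m" using S True fA by (simp add: card_Un_disjoint)
    qed (use D in auto)
  qed auto
  then have "card {S. A \<subseteq> S \<and> S \<subseteq> D \<and> card S = m} = card {S. S \<subseteq> D - A \<and> card S = m - card A}"
    by (rule bij_betw_same_card)
  also have "\<dots> = (card D - card A) choose (m - card A)"
    using D fA n_subsets[of "D - A"] by (simp add: card_Diff_subset)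
  finally show ?thesis using True by simp
next
  case False
  have none: "{S. A \<subseteq> S \<and> S \<subseteq> D \<and> card S = m} = {}"
    using False D by (auto dest: card_mono finite_subset)
  show ?thesis unfolding none using False by simp
qed

text \<open>
  Adding a vertical strip and then removing a horizontal one is compared with the opposite order. In
  either order each row can be treated on its own, and the conditions for a row to admit a choice at all
  are the same: \<open>\<rho> i \<le> Suc (\<alpha> i)\<close> and \<open>\<alpha> (Suc i) \<le> \<rho> i\<close>. If they hold, the rows in \<open>A\<close> are forced to
  take part in the vertical strip, and the other rows that may take part are those of \<open>D'\<close> in the first
  order and those of \<open>D\<close> in the second. As \<open>D'\<close> is \<open>D\<close> shifted by one row with row 0 added, the two
  counts are binomial coefficients that differ by one step of the Pascal recursion.
\<close>

lemma strip_commutation: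
  assumes \<alpha>: "ptn \<alpha>" and \<rho>: "ptn \<rho>"
  shows "card {S. finite S \<and> card S = Suc t \<and> hstrip (add_cells \<alpha> S) \<rho>} =
    card {(\<sigma>, S). finite S \<and> card S = Suc t \<and> hstrip \<alpha> \<sigma> \<and> add_cells \<sigma> S = \<rho>} +
    card {(\<sigma>, S). finite S \<and> card S = t \<and> hstrip \<alpha> \<sigma> \<and> add_cells \<sigma> S = \<rho>}"
    (is "card ?X = card (?Y (Suc t)) + card (?Y t)")
proof (cases "\<forall>i. \<rho> i \<le> Suc (\<alpha> i) \<and> \<alpha> (Suc i) \<le> \<rho> i")
  case False
  then obtain i where i: "Suc (\<alpha> i) < \<rho> i \<or> \<rho> i < \<alpha> (Suc i)" by (auto simp: not_le)
  have "\<not> hstrip (add_cells \<alpha> S) \<rho>" for S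
  proof
    assume "hstrip (add_cells \<alpha> S) \<rho>"
    then have "\<rho> i \<le> add_cells \<alpha> S i" "add_cells \<alpha> S (Suc i) \<le> \<rho> i" by (auto simp: hstrip_def)
    then show False using i by (auto simp: add_cells_def of_bool_def split: if_splits)
  qed
  moreover have "\<not> (hstrip \<alpha> \<sigma> \<and> add_cells \<sigma> S = \<rho>)" for \<sigma> S
  proof
    assume *: "hstrip \<alpha> \<sigma> \<and> add_cells \<sigma> S = \<rho>"
    then have "\<sigma> i \<le> \<alpha> i" "\<alpha> (Suc i) \<le> \<sigma> i" "\<rho> i = \<sigma> i + of_bool (i \<in> S)"
      by (auto simp: hstrip_def add_cells_def)
    then show False using i by (auto simp: of_bool_def split: if_splits)
  qed
  ultimately have "?X = {}" and "\<And>m. ?Y m = {}" by auto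
  then show ?thesis by (simp only: card.empty)
next
  case True
  then have c1: "\<rho> i \<le> Suc (\<alpha> i)" and c2: "\<alpha> (Suc i) \<le> \<rho> i" for i by auto
  have anti: "\<alpha> (Suc i) \<le> \<alpha> i" "\<rho> (Suc i) \<le> \<rho> i" for i
    using \<alpha> \<rho> by (auto simp: ptn_def antimono_def)
  define A where "A = {i. \<rho> i = Suc (\<alpha> i)}"
  \<comment> \<open>Rows from which a cell can be removed without violating the interlacing with the next row of \<open>\<alpha>\<close>.\<close>
  define D where "D = {i. \<alpha> (Suc i) \<noteq> \<rho> i}"
  have finD: "finite D"
  proof (rule finite_subset)
    show "D \<subseteq> {i. \<rho> i \<noteq> 0} \<union> {i. \<alpha> i \<noteq> 0}"
    proof
      fix i assume "i \<in> D"
      then show "i \<in> {i. \<rho> i \<noteq> 0} \<union> {i. \<alpha> i \<noteq> 0}" using anti(1)[of i] by (auto simp: D_def)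
    qed
    show "finite ({i. \<rho> i \<noteq> 0} \<union> {i. \<alpha> i \<noteq> 0})" using \<alpha> \<rho> by (simp add: ptn_def)
  qed
  \<comment> \<open>Rows to which a cell can be added without exceeding the previous row of \<open>\<rho>\<close>; row 0 has no bound.\<close>
  define D' where "D' = insert 0 (Suc ` D)"
  have AD: "A \<subseteq> D"
  proof
    fix i assume "i \<in> A" then show "i \<in> D" using anti(1)[of i] by (auto simp: A_def D_def)
  qed
  have AD': "A \<subseteq> D'"
  proof
    fix i assume i: "i \<in> A"
    show "i \<in> D'"
    proof (cases i)
      case (Suc j)
      then show ?thesis using i anti(2)[of j] by (auto simp: A_def D_def D'_def)
    qed (simp add: D'_def)
  qed
  have finD': "finite D'" and cD': "card D' = Suc (card D)"
    using finD by (auto simp: D'_def card_image)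
  have X1: "hstrip (add_cells \<alpha> S) \<rho> \<longleftrightarrow> A \<subseteq> S \<and> S \<subseteq> D'" for S
  proof -
    have "hstrip (add_cells \<alpha> S) \<rho> \<longleftrightarrow> (\<forall>i. i \<in> A \<longrightarrow> i \<in> S) \<and> (\<forall>i. Suc i \<in> S \<longrightarrow> i \<in> D)"
      unfolding hstrip_def all_conj_distrib
    proof (intro conj_cong all_cong1)
      show "\<rho> i \<le> add_cells \<alpha> S i \<longleftrightarrow> (i \<in> A \<longrightarrow> i \<in> S)" for i
        using c1[of i] by (auto simp: add_cells_def A_def)
      show "add_cells \<alpha> S (Suc i) \<le> \<rho> i \<longleftrightarrow> (Suc i \<in> S \<longrightarrow> i \<in> D)" for i
        using c2[of i] by (auto simp: add_cells_def D_def)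
    qed
    also have "(\<forall>i. Suc i \<in> S \<longrightarrow> i \<in> D) \<longleftrightarrow> S \<subseteq> D'"
    proof
      assume *: "\<forall>i. Suc i \<in> S \<longrightarrow> i \<in> D"
      show "S \<subseteq> D'"
      proof
        fix i assume "i \<in> S" then show "i \<in> D'" using * by (cases i) (auto simp: D'_def)
      qed
    qed (auto simp: D'_def)
    finally show ?thesis by auto
  qed
  have X: "?X = {S. A \<subseteq> S \<and> S \<subseteq> D' \<and> card S = Suc t}"
    using X1 finite_subset[OF _ finD'] by blast
  have Y: "card (?Y m) = card {S. A \<subseteq> S \<and> S \<subseteq> D \<and> card S = m}" for m
  proof -
    have "bij_betw snd (?Y m) {S. A \<subseteq> S \<and> S \<subseteq> D \<and> card S = m}"
    proof (rule bij_betw_byWitness[where f' = "\<lambda>S. (\<lambda>i. \<rho> i - of_bool (i \<in> S), S)"])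
      show "\<forall>a\<in>?Y m. (\<lambda>i. \<rho> i - of_bool (i \<in> snd a), snd a) = a"
        by (auto simp: add_cells_def fun_eq_iff)
      show "snd ` ?Y m \<subseteq> {S. A \<subseteq> S \<and> S \<subseteq> D \<and> card S = m}"
      proof safe
        fix \<sigma> S i assume h: "hstrip \<alpha> \<sigma>" and r: "\<rho> = add_cells \<sigma> S"
        have h': "\<sigma> i \<le> \<alpha> i" "\<alpha> (Suc i) \<le> \<sigma> i" using h by (auto simp: hstrip_def)
        show "i \<in> snd (\<sigma>, S)" if "i \<in> A"
          using that h' by (auto simp: A_def r add_cells_def of_bool_def split: if_splits)
        show "i \<in> D" if "i \<in> snd (\<sigma>, S)"
          using that h' by (auto simp: D_def r add_cells_def)
      qed auto
      show "(\<lambda>S. (\<lambda>i. \<rho> i - of_bool (i \<in> S), S)) ` {S. A \<subseteq> S \<and> S \<subseteq> D \<and> card S = m} \<subseteq> ?Y m"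
      proof safe
        fix S assume S: "A \<subseteq> S" "S \<subseteq> D"
        show "finite S" using S finD finite_subset by blast
        have pos: "\<alpha> (Suc i) < \<rho> i" if "i \<in> S" for i
          using that S(2) c2[of i] by (auto simp: D_def)
        show "hstrip \<alpha> (\<lambda>i. \<rho> i - of_bool (i \<in> S))"
          unfolding hstrip_def
        proof (intro allI conjI)
          fix i
          show "\<rho> i - of_bool (i \<in> S) \<le> \<alpha> i" using subsetD[OF S(1), of i] c1[of i] by (cases "i \<in> S") (auto simp: A_def le_Suc_eq)
          show "\<alpha> (Suc i) \<le> \<rho> i - of_bool (i \<in> S)" using pos[of i] c2[of i] by (auto simp: of_bool_def)
        qed
        show "add_cells (\<lambda>i. \<rho> i - of_bool (i \<in> S)) S = \<rho>"
        proof
          fix i show "add_cells (\<lambda>i. \<rho> i - of_bool (i \<in> S)) S i = \<rho> i"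
            using pos[of i] by (auto simp: add_cells_def of_bool_def)
        qed
      qed
    qed auto
    then show ?thesis by (rule bij_betw_same_card)
  qed
  have le: "card A \<le> card D" using AD finD by (simp add: card_mono)
  show ?thesis
    unfolding X Y card_between[OF finD AD] card_between[OF finD' AD'] cD'
    using le by (auto simp: Suc_diff_le not_le le_Suc_eq)
qed


lemma e_mult_0 [simp]: "e_mult 0 f M = f M"
proof -
  have "{S. S \<subseteq> set_mset M - {0} \<and> card S = 0} = {{}}"
    by (auto dest: finite_subset[of _ "set_mset M - {0}"])
  then show ?thesis by (simp add: e_mult_def)
qed

lemma sum_subsets_insert:
  assumes Z: "finite Z" and n: "n \<notin> Z"
  shows "(\<Sum>S | S \<subseteq> insert n Z \<and> card S = Suc t. f S) =
    (\<Sum>S | S \<subseteq> Z \<and> card S = Suc t. f S) + (\<Sum>S | S \<subseteq> Z \<and> card S = t. f (insert n S))"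
proof -
  have fin: "finite S" if "S \<subseteq> insert n Z" for S by (rule finite_subset[OF that]) (simp add: Z)
  have split: "{S. S \<subseteq> insert n Z \<and> card S = Suc t} =
      {S. S \<subseteq> Z \<and> card S = Suc t} \<union> insert n ` {S. S \<subseteq> Z \<and> card S = t}" (is "?L = ?A \<union> insert n ` ?B")
  proof (rule equalityI)
    show "?L \<subseteq> ?A \<union> insert n ` ?B"
    proof
      fix S assume S: "S \<in> ?L"
      show "S \<in> ?A \<union> insert n ` ?B"
      proof (cases "n \<in> S")
        case True
        then have "S = insert n (S - {n})" "S - {n} \<in> ?B" using S fin[of S] by auto
        then show ?thesis by blast
      qed (use S in auto)
    qed
    show "?A \<union> insert n ` ?B \<subseteq> ?L"
      using n fin by (auto simp: card_insert_if subset_iff)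
  qed
  have inj: "inj_on (insert n) ?B"
  proof (rule inj_onI)
    fix S T assume "S \<in> ?B" "T \<in> ?B" "insert n S = insert n T"
    then show "S = T" using n by (metis (no_types, lifting) Diff_insert_absorb mem_Collect_eq subsetD)
  qed
  show ?thesis
    unfolding split using n Z by (subst sum.union_disjoint) (auto simp: sum.reindex[OF inj])
qed

text \<open>
  The recursion $e_{t+1}(x_1,\dots,x_n) = e_{t+1}(x_1,\dots,x_{n-1}) + x_n e_t(x_1,\dots,x_{n-1})$: the
  squarefree monomial either avoids the last variable or contains it.
\<close>

lemma e_mult_add_colour:
  assumes M: "\<And>x. x \<in># M \<Longrightarrow> x < n" and n: "n \<ge> (1 :: nat)"
  shows "e_mult (Suc t) f (M + replicate_mset (Suc k) n) =
    e_mult (Suc t) (\<lambda>N. f (N + replicate_mset (Suc k) n)) M + e_mult t (\<lambda>N. f (N + replicate_mset k n)) M"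
proof -
  let ?N = "M + replicate_mset (Suc k) n" and ?Z = "set_mset M - {0}"
  have nZ: "n \<notin> ?Z" using M by auto
  have set: "set_mset ?N - {0} = insert n ?Z" using n by auto
  have sub: "finite S \<and> n \<notin> S \<and> mset_set S \<subseteq># M" if "S \<subseteq> ?Z" for S
    using that nZ finite_subset[OF that]
    by (auto simp: subseteq_mset_def count_mset_set' subset_iff Suc_le_eq)
  have "?N - mset_set S = M - mset_set S + replicate_mset (Suc k) n" if "S \<subseteq> ?Z" for S
    using sub[OF that] by (metis add.commute multiset_diff_union_assoc)
  moreover have "?N - mset_set (insert n S) = M - mset_set S + replicate_mset k n" if "S \<subseteq> ?Z" for S
    using sub[OF that] by (simp add: multiset_eq_iff subseteq_mset_def)
  ultimately show ?thesis
    unfolding e_mult_def set by (subst sum_subsets_insert) (use nZ in \<open>auto intro!: arg_cong2[where f = "(+)"] sum.cong\<close>)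
qed

lemma e_mult_sum: "e_mult t (\<lambda>N. \<Sum>x\<in>X. f x N) M = (\<Sum>x\<in>X. e_mult t (f x) M)"
  unfolding e_mult_def by (rule sum.swap)

lemma e_mult_cong:
  assumes "\<And>N. N \<subseteq># M \<Longrightarrow> f N = g N"
  shows "e_mult t f M = e_mult t g M"
  unfolding e_mult_def by (intro sum.cong refl assms) simp

lemma add_cells_empty [simp]: "add_cells \<alpha> {} = \<alpha>"
  by (simp add: add_cells_def fun_eq_iff)

lemma vstrips_0: "ptn \<alpha> \<Longrightarrow> vstrips \<alpha> 0 = {{}}"
  by (auto simp: vstrips_def ptn_def)

lemma add_cells_antimono_of_hstrip: "hstrip (add_cells \<alpha> S) \<rho> \<Longrightarrow> antimono (add_cells \<alpha> S)"
  unfolding hstrip_def by (intro decseq_SucI) (metis order_trans)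

lemma sum_fibres:
  fixes K :: "'b \<Rightarrow> nat"
  assumes "finite P" "finite R" "g ` P \<subseteq> R"
  shows "(\<Sum>p\<in>P. K (g p)) = (\<Sum>\<rho>\<in>R. card {p \<in> P. g p = \<rho>} * K \<rho>)"
proof -
  have "(\<Sum>p\<in>P. K (g p)) = (\<Sum>\<rho>\<in>R. \<Sum>p | p \<in> P \<and> g p = \<rho>. K (g p))"
    using sum.group[OF assms, of "\<lambda>p. K (g p)"] by simp
  also have "\<dots> = (\<Sum>\<rho>\<in>R. card {p \<in> P. g p = \<rho>} * K \<rho>)" by (intro sum.cong) auto
  finally show ?thesis .
qed

definition hstrips :: "nat \<Rightarrow> (nat \<Rightarrow> nat) \<Rightarrow> (nat \<Rightarrow> nat) set" where
  "hstrips k \<alpha> = {\<sigma>. hstrip \<alpha> \<sigma> \<and> card (young \<sigma>) + k = card (young \<alpha>)}"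

text \<open>
  Induction on the number of variables. The branching rule and the recursion for $e_t$ remove the last
  variable from both sides; both become combinations of the counts of tableaux of shape \<open>\<rho>\<close> in the remaining
  variables, and \<open>strip_commutation\<close> says that the count for each \<open>\<rho>\<close> has the same multiplicity.
\<close>

lemma pieri:
  "ptn \<alpha> \<Longrightarrow> set_mset M \<subseteq> {1..n} \<Longrightarrow> e_mult t (kostka \<alpha>) M = (\<Sum>S\<in>vstrips \<alpha> t. kostka (add_cells \<alpha> S) M)"
proof (induction n arbitrary: \<alpha> t M)
  case 0
  then have M: "M = {#}" by simp
  show ?case
  proof (cases t)
    case 0 then show ?thesis using \<open>ptn \<alpha>\<close> by (simp add: vstrips_0)
  next
    case (Suc u)
    have "e_mult t (kostka \<alpha>) M = 0" by (simp add: e_mult_def M Suc)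
    moreover have "tableaux (add_cells \<alpha> S) M = {}" if "S \<in> vstrips \<alpha> t" for S
      using tableaux_size[of _ "add_cells \<alpha> S" M] card_young_add_cells[OF \<open>ptn \<alpha>\<close>, of S] that Suc M
      by (auto simp: vstrips_def)
    ultimately show ?thesis by simp
  qed
next
  case (Suc n)
  define N where "N = filter_mset (\<lambda>x. x < Suc n) M"
  define k where "k = count M (Suc n)"
  have M: "M = N + replicate_mset k (Suc n)"
    using Suc.prems(2) by (auto simp: multiset_eq_iff N_def k_def count_eq_zero_iff)
  have N: "\<And>x. x \<in># N \<Longrightarrow> x < Suc n" "set_mset N \<subseteq> {1..n}" using Suc.prems(2) by (auto simp: N_def)
  note \<alpha> = Suc.prems(1)
  show ?case
  proof (cases "t = 0 \<or> k = 0")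
    case True
    then show ?thesis using Suc.IH[OF \<alpha> N(2)] M \<alpha> by (auto simp: vstrips_0)
  next
    case False
    then obtain u l where t: "t = Suc u" and k: "k = Suc l" by (meson not0_implies_Suc)
    have branch: "kostka \<beta> (L + replicate_mset j (Suc n)) = (\<Sum>\<sigma>\<in>hstrips j \<beta>. kostka \<sigma> L)"
      if "ptn \<beta>" "L \<subseteq># N" for \<beta> L j
      unfolding hstrips_def
      by (rule tableaux_branching[OF that(1)]) (use that N in \<open>auto dest: mset_subset_eqD\<close>)
    have fin: "finite (hstrips j \<beta>)" if "ptn \<beta>" for j \<beta>
      using finite_hstrips[OF that] by (simp add: hstrips_def)
    have hp: "ptn \<sigma>" if "\<sigma> \<in> hstrips j \<beta>" "ptn \<beta>" for \<sigma> \<beta> j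
      using that hstrip_ptn by (auto simp: hstrips_def)
    have vp: "ptn (add_cells \<beta> S)" if "ptn \<beta>" "S \<in> vstrips \<beta> j" for \<beta> S j
      using that ptn_add_cells by (auto simp: vstrips_def)
    define PL where "PL i j = Sigma (hstrips j \<alpha>) (\<lambda>\<sigma>. vstrips \<sigma> i)" for i j
    define PR where "PR = Sigma (vstrips \<alpha> t) (\<lambda>S. hstrips k (add_cells \<alpha> S))"
    define g where "g = (\<lambda>(\<sigma>, S). add_cells \<sigma> S)"
    have finPL: "finite (PL i j)" for i j
      unfolding PL_def using fin[OF \<alpha>] hp \<alpha> finite_vstrips by (intro finite_SigmaI) blast+
    have finPR: "finite PR"
      unfolding PR_def using finite_vstrips[OF \<alpha>] vp[OF \<alpha>] fin by (intro finite_SigmaI) blast+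
    \<comment> \<open>All shapes that remain after the last variable has been removed, on either side.\<close>
    define R where "R = g ` PL t k \<union> g ` PL u l \<union> snd ` PR"
    have finR: "finite R" using finPL finPR by (simp add: R_def)
    have left: "e_mult i (\<lambda>L. kostka \<alpha> (L + replicate_mset j (Suc n))) N =
        (\<Sum>\<rho>\<in>R. card {p \<in> PL i j. g p = \<rho>} * kostka \<rho> N)" if "g ` PL i j \<subseteq> R" for i j
    proof -
      have "e_mult i (\<lambda>L. kostka \<alpha> (L + replicate_mset j (Suc n))) N = (\<Sum>\<sigma>\<in>hstrips j \<alpha>. e_mult i (kostka \<sigma>) N)"
        unfolding e_mult_sum[symmetric] by (rule e_mult_cong) (rule branch[OF \<alpha>])
      also have "\<dots> = (\<Sum>\<sigma>\<in>hstrips j \<alpha>. \<Sum>S\<in>vstrips \<sigma> i. kostka (add_cells \<sigma> S) N)"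
        by (intro sum.cong refl Suc.IH N hp[OF _ \<alpha>])
      also have "\<dots> = (\<Sum>p\<in>PL i j. kostka (g p) N)"
        unfolding PL_def g_def using fin[OF \<alpha>] hp[OF _ \<alpha>] finite_vstrips
        by (subst sum.Sigma) (auto simp: split_def)
      also have "\<dots> = (\<Sum>\<rho>\<in>R. card {p \<in> PL i j. g p = \<rho>} * kostka \<rho> N)"
        by (rule sum_fibres[OF finPL finR that])
      finally show ?thesis .
    qed
    have right: "(\<Sum>S\<in>vstrips \<alpha> t. kostka (add_cells \<alpha> S) M) = (\<Sum>\<rho>\<in>R. card {p \<in> PR. snd p = \<rho>} * kostka \<rho> N)"
    proof -
      have "(\<Sum>S\<in>vstrips \<alpha> t. kostka (add_cells \<alpha> S) M) =
          (\<Sum>S\<in>vstrips \<alpha> t. \<Sum>\<rho>\<in>hstrips k (add_cells \<alpha> S). kostka \<rho> N)"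
        unfolding M by (intro sum.cong refl branch vp[OF \<alpha>] subset_mset.order_refl)
      also have "\<dots> = (\<Sum>p\<in>PR. kostka (snd p) N)"
        unfolding PR_def using finite_vstrips[OF \<alpha>] vp[OF \<alpha>] fin
        by (subst sum.Sigma) (auto simp: split_def)
      also have "\<dots> = (\<Sum>\<rho>\<in>R. card {p \<in> PR. snd p = \<rho>} * kostka \<rho> N)"
        by (rule sum_fibres[OF finPR finR]) (simp add: R_def)
      finally show ?thesis .
    qed
    have fibres: "card {p \<in> PR. snd p = \<rho>} = card {p \<in> PL t k. g p = \<rho>} + card {p \<in> PL u l. g p = \<rho>}"
      if "\<rho> \<in> R" for \<rho>
    proof -
      have L: "ptn \<rho> \<and> card (young \<rho>) + j = card (young \<alpha>) + i" if \<rho>: "\<rho> \<in> g ` PL i j" for i j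
      proof -
        obtain \<sigma> S where *: "\<sigma> \<in> hstrips j \<alpha>" "S \<in> vstrips \<sigma> i" "\<rho> = add_cells \<sigma> S"
          using \<rho> by (auto simp: PL_def g_def)
        then show ?thesis using hp[OF *(1) \<alpha>] vp[of \<sigma> S i] card_young_add_cells[of \<sigma> S]
          by (auto simp: hstrips_def vstrips_def)
      qed
      have \<rho>: "ptn \<rho> \<and> card (young \<rho>) + k = card (young \<alpha>) + t"
        using that unfolding R_def
      proof (elim UnE)
        assume "\<rho> \<in> snd ` PR"
        then obtain S where *: "S \<in> vstrips \<alpha> t" "\<rho> \<in> hstrips k (add_cells \<alpha> S)" by (auto simp: PR_def)
        then show ?thesis using hp[OF *(2) vp[OF \<alpha> *(1)]] card_young_add_cells[OF \<alpha>, of S]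
          by (auto simp: hstrips_def vstrips_def)
      qed (use L[of t k] L[of u l] t k in auto)
      have "bij_betw fst {p \<in> PR. snd p = \<rho>} {S. finite S \<and> card S = t \<and> hstrip (add_cells \<alpha> S) \<rho>}"
        by (rule bij_betw_byWitness[where f' = "\<lambda>S. (S, \<rho>)"])
           (use \<rho> card_young_add_cells[OF \<alpha>] add_cells_antimono_of_hstrip in
             \<open>auto simp: PR_def hstrips_def vstrips_def\<close>)
      moreover have "{p \<in> PL i j. g p = \<rho>} =
          {(\<sigma>, S). finite S \<and> card S = i \<and> hstrip \<alpha> \<sigma> \<and> add_cells \<sigma> S = \<rho>}"
        if "card (young \<rho>) + j = card (young \<alpha>) + i" for i j
        using that \<rho> card_young_add_cells[OF hstrip_ptn[OF \<alpha>]]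
        by (fastforce simp: PL_def g_def hstrips_def vstrips_def ptn_def)
      ultimately show ?thesis
        using strip_commutation[OF \<alpha> conjunct1[OF \<rho>], of u] \<rho> t k by (simp add: bij_betw_same_card)
    qed
    have "e_mult t (kostka \<alpha>) M = e_mult t (\<lambda>L. kostka \<alpha> (L + replicate_mset k (Suc n))) N
        + e_mult u (\<lambda>L. kostka \<alpha> (L + replicate_mset l (Suc n))) N"
      unfolding M t k by (rule e_mult_add_colour[OF N(1)]) auto
    also have "\<dots> = (\<Sum>\<rho>\<in>R. card {p \<in> PR. snd p = \<rho>} * kostka \<rho> N)"
      by (subst (1 2) left) (auto simp: R_def fibres[unfolded R_def] sum.distrib[symmetric] distrib_right intro!: sum.cong)
    finally show ?thesis using right by simp
  qed
qed

section \<open>Schur functions in terms of shapes\<close>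

lemma shape_simps [simp]: "shape [] i = 0" "shape (a # \<nu>) 0 = a" "shape (a # \<nu>) (Suc i) = shape \<nu> i"
  by (auto simp: nth_default_def)

lemma young_shape: "young (shape \<nu>) = cells \<nu>"
proof -
  have "j < shape \<nu> i \<longleftrightarrow> i < length \<nu> \<and> j < \<nu> ! i" for i j by (simp add: nth_default_def)
  then show ?thesis by (simp add: young_def cells_def)
qed

lemma schur_eq_kostka: "schur \<nu> M = of_nat (kostka (shape \<nu>) M)"
proof -
  have "(i, j) \<in> cells \<nu> \<longleftrightarrow> j < shape \<nu> i" for i j by (auto simp: young_shape[symmetric])
  then have "{T \<in> SSYT \<nu>. image_mset T (mset_set (cells \<nu>)) = M} = tableaux (shape \<nu>) M"
    by (auto simp: SSYT_def tableaux_def young_shape)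
  then show ?thesis by (simp add: schur_def)
qed

lemma card_young_sum:
  assumes "\<And>i. i \<ge> N \<Longrightarrow> \<alpha> i = 0"
  shows "card (young \<alpha>) = (\<Sum>i<N. \<alpha> i)"
proof -
  have "young \<alpha> = (SIGMA i:{..<N}. {..<\<alpha> i})" using assms by (force simp: young_def not_le)
  then show ?thesis by simp
qed

lemma card_young_shape: "card (young (shape \<nu>)) = sum_list \<nu>"
  by (subst card_young_sum[of "length \<nu>"])
     (auto simp: nth_default_def sum_list_sum_nth atLeast0LessThan)

lemma ptn_shape:
  assumes "sorted_wrt (\<ge>) \<nu>" shows "ptn (shape \<nu>)"
  unfolding ptn_def
proof
  have "shape \<nu> (Suc i) \<le> shape \<nu> i" for i
    using sorted_wrt_nth_less[OF assms, of i "Suc i"] by (auto simp: nth_default_def)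
  then show "antimono (shape \<nu>)" by (rule decseq_SucI)
  have "{i. shape \<nu> i \<noteq> 0} \<subseteq> {..<length \<nu>}" by (auto simp: nth_default_def)
  then show "finite {i. shape \<nu> i \<noteq> 0}" by (rule finite_subset) simp
qed

lemma ptn_shape_partition: "is_partition \<nu> \<Longrightarrow> ptn (shape \<nu>)"
  by (simp add: is_partition_def ptn_shape)

lemma ex_partition_shape:
  assumes \<alpha>: "ptn \<alpha>" obtains \<nu> where "is_partition \<nu>" "shape \<nu> = \<alpha>"
proof
  have ex: "\<exists>i. \<alpha> i = 0"
  proof (rule ccontr)
    assume "\<nexists>i. \<alpha> i = 0"
    then have "{i. \<alpha> i \<noteq> 0} = UNIV" by auto
    then show False using \<alpha> by (simp add: ptn_def)
  qed
  define n where "n = (LEAST i. \<alpha> i = 0)"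
  have n0: "\<alpha> n = 0" unfolding n_def by (rule LeastI_ex[OF ex])
  have pos: "\<alpha> i \<noteq> 0" if "i < n" for i using that unfolding n_def by (rule not_less_Least)
  have anti: "i \<le> j \<Longrightarrow> \<alpha> j \<le> \<alpha> i" for i j using \<alpha> by (auto simp: ptn_def antimono_def)
  have "0 \<notin> set (map \<alpha> [0..<n])"
  proof
    assume "0 \<in> set (map \<alpha> [0..<n])"
    then obtain i where "i < n" "0 = \<alpha> i" by auto
    then show False using pos[of i] by simp
  qed
  moreover have "sorted_wrt (\<ge>) (map \<alpha> [0..<n])" using anti by (simp add: sorted_wrt_iff_nth_less)
  ultimately show "is_partition (map \<alpha> [0..<n])" by (simp add: is_partition_def)
  show "shape (map \<alpha> [0..<n]) = \<alpha>"
  proof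
    fix i show "shape (map \<alpha> [0..<n]) i = \<alpha> i" using anti[of n i] n0 by (simp add: nth_default_def)
  qed
qed

text \<open>
  The skew shape \<open>\<mu>/\<nu>\<close> is a vertical strip.
\<close>

definition vertical :: "nat list \<Rightarrow> nat list \<Rightarrow> bool" where
  "vertical \<nu> \<mu> \<longleftrightarrow> (\<forall>i. shape \<nu> i \<le> shape \<mu> i \<and> shape \<mu> i \<le> Suc (shape \<nu> i))"

lemma pieri_schur:
  assumes \<nu>: "is_partition \<nu>" and M: "0 \<notin># M"
  shows "e_mult t (schur \<nu>) M = (\<Sum>\<mu> | \<mu> \<in> partitions_of (sum_list \<nu> + t) \<and> vertical \<nu> \<mu>. schur \<mu> M)"
proof -
  let ?\<alpha> = "shape \<nu>"
  let ?Q = "{\<mu>. \<mu> \<in> partitions_of (sum_list \<nu> + t) \<and> vertical \<nu> \<mu>}"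
  define D where "D \<mu> = {i. shape \<mu> i \<noteq> ?\<alpha> i}" for \<mu>
  have \<alpha>: "ptn ?\<alpha>" by (rule ptn_shape_partition[OF \<nu>])
  have add_cells_D: "add_cells ?\<alpha> (D \<mu>) = shape \<mu>" if "vertical \<nu> \<mu>" for \<mu>
    using that by (auto simp: add_cells_def D_def vertical_def fun_eq_iff of_bool_def le_Suc_eq) (metis le_Suc_eq le_antisym)
  have finD: "finite (D \<mu>)" for \<mu>
    by (rule finite_subset[of _ "{..<length \<mu> + length \<nu>}"]) (auto simp: D_def nth_default_def split: if_splits)
  have bij: "bij_betw D ?Q (vstrips ?\<alpha> t)"
    unfolding bij_betw_def
  proof
    show "inj_on D ?Q"
    proof (rule inj_onI)
      fix \<mu> \<xi> assume "\<mu> \<in> ?Q" "\<xi> \<in> ?Q" "D \<mu> = D \<xi>"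
      then show "\<mu> = \<xi>" using add_cells_D[of \<mu>] add_cells_D[of \<xi>] by (auto simp: partitions_of_def intro: partition_eqI)
    qed
    show "D ` ?Q = vstrips ?\<alpha> t"
    proof (intro equalityI subsetI)
      fix S assume "S \<in> D ` ?Q"
      then obtain \<mu> where \<mu>: "\<mu> \<in> ?Q" "S = D \<mu>" by auto
      have "card (D \<mu>) = t"
        using card_young_add_cells[OF \<alpha> finD, of \<mu>] add_cells_D[of \<mu>] \<mu> by (simp add: card_young_shape partitions_of_def)
      then show "S \<in> vstrips ?\<alpha> t"
        using \<mu> finD add_cells_D[of \<mu>] ptn_shape_partition[of \<mu>] by (simp add: vstrips_def partitions_of_def ptn_def)
    next
      fix S assume S: "S \<in> vstrips ?\<alpha> t"
      then have "ptn (add_cells ?\<alpha> S)" using ptn_add_cells[OF \<alpha>] by (simp add: vstrips_def)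
      then obtain \<mu> where \<mu>: "is_partition \<mu>" "shape \<mu> = add_cells ?\<alpha> S" by (rule ex_partition_shape)
      have "sum_list \<mu> = sum_list \<nu> + t"
        using card_young_add_cells[OF \<alpha>, of S] S \<mu> card_young_shape[of \<mu>] by (simp add: vstrips_def card_young_shape)
      then have "\<mu> \<in> ?Q" using \<mu> by (simp add: partitions_of_def vertical_def add_cells_def)
      moreover have "S = D \<mu>" using \<mu> by (auto simp: D_def add_cells_def)
      ultimately show "S \<in> D ` ?Q" by blast
    qed
  qed
  obtain n where n: "set_mset M \<subseteq> {1..n}"
  proof
    show "set_mset M \<subseteq> {1..Max (set_mset M)}" using M by (auto simp: Suc_le_eq intro: gr0I)
  qed
  have "e_mult t (schur \<nu>) M = of_nat (e_mult t (kostka ?\<alpha>) M)"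
    by (simp add: e_mult_def schur_eq_kostka)
  also have "\<dots> = (\<Sum>S\<in>vstrips ?\<alpha> t. of_nat (kostka (add_cells ?\<alpha> S) M))" by (simp add: pieri[OF \<alpha> n])
  also have "\<dots> = (\<Sum>\<mu>\<in>?Q. of_nat (kostka (add_cells ?\<alpha> (D \<mu>)) M))"
    by (rule sum.reindex_bij_betw[OF bij, symmetric])
  also have "\<dots> = (\<Sum>\<mu>\<in>?Q. schur \<mu> M)"
    by (intro sum.cong) (auto simp: add_cells_D schur_eq_kostka)
  finally show ?thesis .
qed

lemma tableaux_col_ge:
  assumes T: "T \<in> tableaux \<alpha> M" and \<alpha>: "antimono \<alpha>"
  shows "j < \<alpha> i \<Longrightarrow> Suc i \<le> T (i, j)"
proof (induction i)
  case 0 then show ?case using T by (auto simp: tableaux_def PiE_iff)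
next
  case (Suc i)
  have "\<alpha> (Suc i) \<le> \<alpha> i" using \<alpha> by (auto simp: antimono_def)
  then have "j < \<alpha> i" using Suc.prems by simp
  then have "Suc i \<le> T (i, j)" "T (i, j) < T (Suc i, j)" using Suc T by (auto simp: tableaux_def)
  then show ?case by simp
qed

text \<open>
  The entry in row \<open>i\<close> is at least \<open>Suc i\<close>, so that the entries up to \<open>k\<close> all lie in the first \<open>k\<close> rows;
  there are as many such entries as the first \<open>k\<close> parts of \<open>\<mu>\<close> add up to.
\<close>

lemma schur_canon_dominance:
  assumes \<nu>: "is_partition \<nu>" and nz: "schur \<nu> (canon \<mu>) \<noteq> 0"
  shows "dominance_ge \<nu> \<mu>"
  unfolding dominance_ge_iff
proof
  fix k
  let ?\<alpha> = "shape \<nu>"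
  have \<alpha>: "ptn ?\<alpha>" by (rule ptn_shape_partition[OF \<nu>])
  obtain T where T: "T \<in> tableaux ?\<alpha> (canon \<mu>)"
    using nz by (auto simp: schur_eq_kostka card_eq_0_iff)
  have fin: "finite (young ?\<alpha>)" by (rule finite_young[OF \<alpha>])
  have "(\<Sum>i<k. shape \<mu> i) = (\<Sum>i<k. card {c \<in> young ?\<alpha>. T c = Suc i})"
  proof (rule sum.cong[OF refl])
    fix i
    have "shape \<mu> i = count (image_mset T (mset_set (young ?\<alpha>))) (Suc i)"
      using T by (simp add: tableaux_def)
    also have "\<dots> = card {c \<in> young ?\<alpha>. T c = Suc i}"
      using fin by (auto simp: count_image_mset intro!: arg_cong[where f = card])
    finally show "shape \<mu> i = card {c \<in> young ?\<alpha>. T c = Suc i}" .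
  qed
  also have "\<dots> = card (\<Union>i<k. {c \<in> young ?\<alpha>. T c = Suc i})"
    using fin by (intro card_UN_disjoint[symmetric]) auto
  also have "\<dots> \<le> card (SIGMA i:{..<k}. {..<?\<alpha> i})"
  proof (rule card_mono)
    show "(\<Union>i<k. {c \<in> young ?\<alpha>. T c = Suc i}) \<subseteq> (SIGMA i:{..<k}. {..<?\<alpha> i})"
      using tableaux_col_ge[OF T] \<alpha> by (force simp: ptn_def)
  qed simp
  also have "\<dots> = (\<Sum>i<k. ?\<alpha> i)" by simp
  finally show "(\<Sum>i<k. shape \<mu> i) \<le> (\<Sum>i<k. ?\<alpha> i)" .
qed

text \<open>
  The tableau that has the entry \<open>Suc i\<close> throughout row \<open>i\<close> is semistandard.
\<close>

lemma schur_canon_self: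
  assumes \<nu>: "is_partition \<nu>" shows "schur \<nu> (canon \<nu>) \<noteq> 0"
proof -
  let ?\<alpha> = "shape \<nu>"
  have \<alpha>: "ptn ?\<alpha>" by (rule ptn_shape_partition[OF \<nu>])
  have fin: "finite (young ?\<alpha>)" by (rule finite_young[OF \<alpha>])
  define T where "T = restrict (\<lambda>(i, j :: nat). Suc i) (young ?\<alpha>)"
  have "count (image_mset T (mset_set (young ?\<alpha>))) x = count (canon \<nu>) x" for x
  proof (cases x)
    case 0
    then show ?thesis using fin by (auto simp: T_def count_eq_zero_iff)
  next
    case (Suc i)
    have "count (image_mset T (mset_set (young ?\<alpha>))) x = card {c \<in> young ?\<alpha>. T c = x}"
      using fin by (auto simp: count_image_mset intro!: arg_cong[where f = card])
    also have "{c \<in> young ?\<alpha>. T c = x} = Pair i ` {..<?\<alpha> i}" by (auto simp: T_def Suc)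
    finally show ?thesis by (simp add: Suc card_image inj_on_def)
  qed
  then have "image_mset T (mset_set (young ?\<alpha>)) = canon \<nu>" by (rule multiset_eqI)
  then have "T \<in> tableaux ?\<alpha> (canon \<nu>)"
    using \<alpha> by (auto simp: tableaux_def T_def)
  then show ?thesis using finite_tableaux[OF \<alpha>] by (auto simp: schur_eq_kostka)
qed

lemmas basis_coeff_schur = basis_coeff_triangular[where b = schur, OF schur_canon_dominance schur_canon_self]

text \<open>
  Lists keep their length, with zeros for rows that
  have become empty, so that the rows of the two shapes correspond position by position.
\<close>

fun hstrip_lists :: "nat list \<Rightarrow> nat list list" where
  "hstrip_lists [] = [[]]"
| "hstrip_lists [a] = map (\<lambda>s. [s]) [0..<Suc a]"
| "hstrip_lists (a # b # \<nu>) = concat (map (\<lambda>s. map ((#) s) (hstrip_lists (b # \<nu>))) [b..<Suc a])"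

text \<open>
  Kostka numbers by the branching rule. The second argument lists the multiplicities of the entries from
  the largest entry to the smallest.
\<close>

fun kostka_list :: "nat list \<Rightarrow> nat list \<Rightarrow> nat" where
  "kostka_list \<nu> [] = (if sum_list \<nu> = 0 then 1 else 0)"
| "kostka_list \<nu> (c # cs) =
    sum_list (map (\<lambda>\<sigma>. kostka_list \<sigma> cs) (filter (\<lambda>\<sigma>. sum_list \<sigma> + c = sum_list \<nu>) (hstrip_lists \<nu>)))"

lemma hstrip_Cons2: "hstrip (shape (a # b # \<nu>)) (shape (s # \<sigma>)) \<longleftrightarrow>
    b \<le> s \<and> s \<le> a \<and> hstrip (shape (b # \<nu>)) (shape \<sigma>)"
proof -
  have *: "(\<forall>i. P i) \<longleftrightarrow> P 0 \<and> (\<forall>i. P (Suc i))" for P :: "nat \<Rightarrow> bool" by (metis not0_implies_Suc)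
  show ?thesis unfolding hstrip_def by (subst *) auto
qed

lemma set_hstrip_lists:
  "set (hstrip_lists \<nu>) = {\<sigma>. length \<sigma> = length \<nu> \<and> hstrip (shape \<nu>) (shape \<sigma>)}"
proof (induction \<nu> rule: hstrip_lists.induct)
  case 1
  then show ?case by (auto simp: hstrip_def)
next
  case (2 a)
  have 1: "hstrip (shape [a]) (shape [s]) \<longleftrightarrow> s \<le> a" for s
    by (auto simp: hstrip_def nth_default_def)
  have "set (hstrip_lists [a]) = (\<lambda>s. [s]) ` {..a}"
    by (simp add: atLeast0LessThan lessThan_Suc_atMost del: upt_Suc)
  also have "\<dots> = {\<sigma>. length \<sigma> = length [a] \<and> hstrip (shape [a]) (shape \<sigma>)}"
  proof (intro equalityI subsetI)
    fix \<sigma> assume \<sigma>: "\<sigma> \<in> {\<sigma>. length \<sigma> = length [a] \<and> hstrip (shape [a]) (shape \<sigma>)}"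
    then obtain s where "\<sigma> = [s]" by (cases \<sigma>) auto
    then show "\<sigma> \<in> (\<lambda>s. [s]) ` {..a}" using \<sigma> 1[of s] by simp
  next
    fix \<sigma> assume "\<sigma> \<in> (\<lambda>s. [s]) ` {..a}"
    then obtain s where "\<sigma> = [s]" "s \<le> a" by blast
    then show "\<sigma> \<in> {\<sigma>. length \<sigma> = length [a] \<and> hstrip (shape [a]) (shape \<sigma>)}" using 1[of s] by simp
  qed
  finally show ?case .
next
  case (3 a b \<nu>)
  show ?case
  proof (intro equalityI subsetI)
    fix \<sigma> assume "\<sigma> \<in> set (hstrip_lists (a # b # \<nu>))"
    then obtain s \<tau> where "\<sigma> = s # \<tau>" "b \<le> s" "s \<le> a" "\<tau> \<in> set (hstrip_lists (b # \<nu>))" by auto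
    then show "\<sigma> \<in> {\<sigma>. length \<sigma> = length (a # b # \<nu>) \<and> hstrip (shape (a # b # \<nu>)) (shape \<sigma>)}"
      using 3 hstrip_Cons2 by auto
  next
    fix \<sigma> assume \<sigma>: "\<sigma> \<in> {\<sigma>. length \<sigma> = length (a # b # \<nu>) \<and> hstrip (shape (a # b # \<nu>)) (shape \<sigma>)}"
    then obtain s \<tau> where s: "\<sigma> = s # \<tau>" by (cases \<sigma>) auto
    then have "b \<le> s" "s \<le> a" "\<tau> \<in> set (hstrip_lists (b # \<nu>))"
      using \<sigma> 3 hstrip_Cons2[of a b \<nu> s \<tau>] by auto
    then show "\<sigma> \<in> set (hstrip_lists (a # b # \<nu>))" using s by (cases "s = a") auto
  qed
qed

lemma distinct_prefixed_lists:
  "distinct L \<Longrightarrow> distinct xs \<Longrightarrow> distinct (concat (map (\<lambda>s. map ((#) s) L) xs))"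
  by (induction xs) (auto simp: distinct_map)

lemma distinct_hstrip_lists: "distinct (hstrip_lists \<nu>)"
proof (induction \<nu> rule: hstrip_lists.induct)
  case (3 a b \<nu>)
  show ?case
  proof (cases "[b..<Suc a] = []")
    case False
    then have "distinct (hstrip_lists (b # \<nu>))" using 3 by (metis list.set_sel(1))
    then show ?thesis unfolding hstrip_lists.simps by (rule distinct_prefixed_lists) simp
  qed (simp only: hstrip_lists.simps list.map concat.simps distinct.simps)
qed (auto simp: distinct_map inj_on_def)

lemma sum_hstrips_shape:
  assumes "ptn (shape \<nu>)"
  shows "(\<Sum>\<sigma>\<in>hstrips k (shape \<nu>). g \<sigma>) =
    sum_list (map (\<lambda>\<sigma>. g (shape \<sigma>)) (filter (\<lambda>\<sigma>. sum_list \<sigma> + k = sum_list \<nu>) (hstrip_lists \<nu>)))"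
proof -
  let ?L = "filter (\<lambda>\<sigma>. sum_list \<sigma> + k = sum_list \<nu>) (hstrip_lists \<nu>)"
  have inj: "inj_on shape (set ?L)"
  proof (rule inj_onI)
    fix \<sigma> \<tau> assume a: "\<sigma> \<in> set ?L" "\<tau> \<in> set ?L" and e: "shape \<sigma> = shape \<tau>"
    show "\<sigma> = \<tau>"
    proof (rule nth_equalityI)
      show "\<sigma> ! i = \<tau> ! i" if "i < length \<sigma>" for i
        using fun_cong[OF e, of i] a that by (simp add: nth_default_def set_hstrip_lists)
    qed (use a in \<open>simp add: set_hstrip_lists\<close>)
  qed
  have "hstrips k (shape \<nu>) = shape ` set ?L"
  proof (intro equalityI subsetI)
    fix \<sigma> assume \<sigma>: "\<sigma> \<in> hstrips k (shape \<nu>)"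
    define l where "l = map \<sigma> [0..<length \<nu>]"
    have "\<sigma> i \<le> shape \<nu> i" for i using \<sigma> by (simp add: hstrips_def hstrip_def)
    then have "\<sigma> i = 0" if "i \<ge> length \<nu>" for i using that by (metis le_zero_eq nth_default_beyond)
    then have "shape l = \<sigma>" by (auto simp: l_def nth_default_def fun_eq_iff)
    then have "l \<in> set ?L"
      using \<sigma> card_young_shape[of l] by (auto simp: hstrips_def set_hstrip_lists card_young_shape l_def)
    then show "\<sigma> \<in> shape ` set ?L" using \<open>shape l = \<sigma>\<close> by blast
  qed (auto simp: hstrips_def set_hstrip_lists card_young_shape)
  then have "(\<Sum>\<sigma>\<in>hstrips k (shape \<nu>). g \<sigma>) = (\<Sum>\<sigma>\<in>set ?L. g (shape \<sigma>))"
    by (simp only: sum.reindex[OF inj] comp_def)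
  also have "\<dots> = sum_list (map (\<lambda>\<sigma>. g (shape \<sigma>)) ?L)"
    using distinct_hstrip_lists by (simp add: sum_list_distinct_conv_sum_set)
  finally show ?thesis .
qed

lemma kostka_eq_kostka_list:
  assumes "ptn (shape \<nu>)" "sorted_wrt (>) xs" "set_mset M \<subseteq> set xs" "set xs \<subseteq> {1..}"
  shows "kostka (shape \<nu>) M = kostka_list \<nu> (map (count M) xs)"
  using assms
proof (induction xs arbitrary: \<nu> M)
  case Nil
  then have M: "M = {#}" by simp
  show ?case
  proof (cases "sum_list \<nu> = 0")
    case True
    then have "young (shape \<nu>) = {}" using card_young_shape[of \<nu>] finite_young[OF Nil(1)]
      by (metis card_0_eq)
    then have "tableaux (shape \<nu>) M = {\<lambda>_. undefined}"
      unfolding tableaux_def M by (auto simp: young_def)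
    then show ?thesis using True by simp
  next
    case False
    have "tableaux (shape \<nu>) M = {}"
    proof (rule ccontr)
      assume "tableaux (shape \<nu>) M \<noteq> {}"
      then obtain T where "T \<in> tableaux (shape \<nu>) M" by blast
      then show False using tableaux_size[of T "shape \<nu>" M] False card_young_shape[of \<nu>] M by (metis size_empty)
    qed
    then show ?thesis using False by simp
  qed
next
  case (Cons x xs)
  define N where "N = filter_mset (\<lambda>y. y < x) M"
  have M: "M = N + replicate_mset (count M x) x"
    using Cons.prems(2,3) by (auto simp: multiset_eq_iff N_def count_eq_zero_iff)
  have cN: "map (count M) xs = map (count N) xs" using Cons.prems(2) by (simp add: N_def)
  have xs: "sorted_wrt (>) xs" "set_mset N \<subseteq> set xs" "set xs \<subseteq> {1..}" using Cons.prems by (auto simp: N_def)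
  have "kostka (shape \<nu>) M = (\<Sum>\<sigma>\<in>hstrips (count M x) (shape \<nu>). kostka \<sigma> N)"
    unfolding hstrips_def
    by (subst M, rule tableaux_branching[OF Cons.prems(1)]) (use Cons.prems in \<open>auto simp: N_def\<close>)
  also have "\<dots> = kostka_list \<nu> (map (count M) (x # xs))"
    unfolding sum_hstrips_shape[OF Cons.prems(1)] list.map kostka_list.simps cN
    using Cons.IH[OF _ xs] hstrip_ptn[OF Cons.prems(1)]
    by (intro arg_cong[where f = sum_list] map_cong refl) (auto simp: set_hstrip_lists)
  finally show ?case .
qed

section \<open>Chromatic symmetric functions by colour classes\<close>

definition colorings :: "'a set \<Rightarrow> ('a \<times> 'a) set \<Rightarrow> nat multiset \<Rightarrow> ('a \<Rightarrow> nat) set" where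
  "colorings V R M = {\<kappa> \<in> V \<rightarrow>\<^sub>E {1..}.
     (\<forall>u\<in>V. \<forall>v\<in>V. (u, v) \<in> R \<longrightarrow> \<kappa> u \<noteq> \<kappa> v) \<and> image_mset \<kappa> (mset_set V) = M}"

definition stable :: "('a \<times> 'a) set \<Rightarrow> 'a set \<Rightarrow> bool" where
  "stable R S \<longleftrightarrow> (\<forall>u\<in>S. \<forall>v\<in>S. (u, v) \<notin> R)"

lemma chromatic_sym_eq_card:
  assumes "pair_graph G"
  shows "chromatic_sym G M = of_nat (card (colorings (pverts G) (parcs G) M))"
proof -
  interpret pair_graph G by fact
  have "{\<kappa> \<in> proper_colorings G. image_mset \<kappa> (mset_set (pverts G)) = M} = colorings (pverts G) (parcs G) M"
    by (auto simp: proper_colorings_def colorings_def dest: wellformed')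
  then show ?thesis by (simp add: chromatic_sym_def)
qed

lemma finite_colorings:
  assumes "finite V" shows "finite (colorings V R M)"
proof (rule finite_subset)
  show "colorings V R M \<subseteq> V \<rightarrow>\<^sub>E set_mset M"
    using assms by (auto simp: colorings_def PiE_iff extensional_def)
  show "finite (V \<rightarrow>\<^sub>E set_mset M)" by (intro finite_PiE assms) simp
qed

lemma colorings_content:
  "\<kappa> \<in> colorings V R M \<Longrightarrow> size M = card V" "finite V \<Longrightarrow> \<kappa> \<in> colorings V R M \<Longrightarrow> 0 \<notin># M"
  by (auto simp: colorings_def) force

lemma card_colorings_restrict:
  assumes V: "finite V" and x: "x \<ge> 1" "x \<notin># N" and S: "S \<subseteq> V" "card S = k" "stable R S"
  shows "card {\<kappa> \<in> colorings V R (N + replicate_mset k x). {v \<in> V. \<kappa> v = x} = S} =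
    card (colorings (V - S) R N)" (is "card ?F = _")
proof -
  have fin: "finite S" "finite (V - S)" using V S finite_subset by auto
  have Vms: "mset_set V = mset_set (V - S) + mset_set S"
    using fin S by (metis Diff_disjoint Diff_partition add.commute mset_set_Union)
  have const: "image_mset \<kappa> (mset_set S) = replicate_mset k x" if "\<And>v. v \<in> S \<Longrightarrow> \<kappa> v = x" for \<kappa> :: "'a \<Rightarrow> nat"
    using that fin S by (subst image_mset_cong[where g = "\<lambda>_. x"]) (auto simp: image_mset_const_eq)
  define ext where "ext \<kappa> = (\<lambda>v. if v \<in> S then x else \<kappa> v)" for \<kappa> :: "'a \<Rightarrow> nat"
  have "bij_betw (\<lambda>\<kappa>. restrict \<kappa> (V - S)) ?F (colorings (V - S) R N)"
  proof (rule bij_betw_byWitness[where f' = ext])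
    show "\<forall>\<kappa>\<in>?F. ext (restrict \<kappa> (V - S)) = \<kappa>"
      by (auto simp: ext_def fun_eq_iff colorings_def PiE_iff extensional_def)
    show "\<forall>\<kappa>\<in>colorings (V - S) R N. restrict (ext \<kappa>) (V - S) = \<kappa>"
      by (auto simp: ext_def fun_eq_iff colorings_def PiE_iff extensional_def restrict_def)
    show "(\<lambda>\<kappa>. restrict \<kappa> (V - S)) ` ?F \<subseteq> colorings (V - S) R N"
    proof
      fix \<kappa>' assume "\<kappa>' \<in> (\<lambda>\<kappa>. restrict \<kappa> (V - S)) ` ?F"
      then obtain \<kappa> where \<kappa>: "\<kappa> \<in> ?F" "\<kappa>' = restrict \<kappa> (V - S)" by blast
      have S': "\<kappa> v = x" if "v \<in> S" for v using \<kappa>(1) that by blast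
      have "image_mset \<kappa> (mset_set (V - S)) + replicate_mset k x = N + replicate_mset k x"
        using \<kappa>(1) const[of \<kappa>, OF S'] Vms by (simp add: colorings_def)
      moreover have "image_mset \<kappa>' (mset_set (V - S)) = image_mset \<kappa> (mset_set (V - S))"
        using fin by (intro image_mset_cong) (auto simp: \<kappa>)
      ultimately show "\<kappa>' \<in> colorings (V - S) R N" using \<kappa> by (simp add: colorings_def PiE_iff)
    qed
    show "ext ` colorings (V - S) R N \<subseteq> ?F"
    proof
      fix \<kappa>' assume "\<kappa>' \<in> ext ` colorings (V - S) R N"
      then obtain \<kappa> where \<kappa>: "\<kappa> \<in> colorings (V - S) R N" "\<kappa>' = ext \<kappa>" by blast
      have ne: "\<kappa> v \<noteq> x" if "v \<in> V - S" for v
      proof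
        assume "\<kappa> v = x"
        then have "x \<in># image_mset \<kappa> (mset_set (V - S))" using that fin by force
        moreover have "image_mset \<kappa> (mset_set (V - S)) = N" using \<kappa>(1) by (simp add: colorings_def)
        ultimately show False using x(2) by (simp only:)
      qed
      have "image_mset \<kappa>' (mset_set (V - S)) = image_mset \<kappa> (mset_set (V - S))"
        using fin by (intro image_mset_cong) (auto simp: \<kappa> ext_def)
      then have "image_mset \<kappa>' (mset_set V) = N + replicate_mset k x"
        using Vms const[of \<kappa>'] \<kappa> by (simp add: colorings_def ext_def)
      moreover have "\<kappa>' \<in> V \<rightarrow>\<^sub>E {1..}"
        using \<kappa> x S by (auto simp: colorings_def ext_def PiE_iff extensional_def)
      moreover have "\<forall>u\<in>V. \<forall>v\<in>V. (u, v) \<in> R \<longrightarrow> \<kappa>' u \<noteq> \<kappa>' v"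
        using \<kappa> ne S(3) ne[symmetric] by (auto simp: colorings_def ext_def stable_def)
      moreover have "{v \<in> V. \<kappa>' v = x} = S" using \<kappa> ne S by (auto simp: ext_def)
      ultimately show "\<kappa>' \<in> ?F" by (simp add: colorings_def)
    qed
  qed
  then show ?thesis by (rule bij_betw_same_card)
qed

text \<open>
  The class of the colour \<open>x\<close> is a stable set of the prescribed size, and the other vertices are coloured
  independently of it. In contrast to the branching rule for tableaux, the colours can be removed in any order.
\<close>

lemma colorings_branching:
  assumes V: "finite V" and x: "x \<ge> 1" "x \<notin># N"
  shows "card (colorings V R (N + replicate_mset k x)) =
    (\<Sum>S | S \<subseteq> V \<and> card S = k \<and> stable R S. card (colorings (V - S) R N))"
proof -
  let ?C = "colorings V R (N + replicate_mset k x)"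
  let ?I = "{S. S \<subseteq> V \<and> card S = k \<and> stable R S}"
  define F where "F S = {\<kappa> \<in> ?C. {v \<in> V. \<kappa> v = x} = S}" for S
  have "?C = (\<Union>S\<in>?I. F S)"
  proof (intro equalityI subsetI)
    fix \<kappa> assume \<kappa>: "\<kappa> \<in> ?C"
    let ?S = "{v \<in> V. \<kappa> v = x}"
    have "card ?S = count (image_mset \<kappa> (mset_set V)) x"
      using V by (auto simp: count_image_mset intro!: arg_cong[where f = card])
    also have "\<dots> = k" using \<kappa> x by (simp add: colorings_def count_eq_zero_iff)
    finally have k: "card ?S = k" .
    have "\<forall>u\<in>V. \<forall>v\<in>V. (u, v) \<in> R \<longrightarrow> \<kappa> u \<noteq> \<kappa> v" using \<kappa> by (simp add: colorings_def)
    then have "stable R ?S" unfolding stable_def by (metis (mono_tags, lifting) mem_Collect_eq)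
    then have "?S \<in> ?I" using k by blast
    then show "\<kappa> \<in> (\<Union>S\<in>?I. F S)" using \<kappa> by (auto simp: F_def)
  qed (auto simp: F_def)
  then have "card ?C = card (\<Union>S\<in>?I. F S)" by simp
  also have "\<dots> = (\<Sum>S\<in>?I. card (F S))"
    using V finite_colorings[OF V] by (intro card_UN_disjoint) (auto simp: F_def)
  also have "\<dots> = (\<Sum>S\<in>?I. card (colorings (V - S) R N))"
    using card_colorings_restrict[OF V x] by (intro sum.cong) (auto simp: F_def)
  finally show ?thesis .
qed

text \<open>
  The number of colorings as it follows from the recursion, as a function of the sizes of the colour classes.
\<close>

fun chrom_count :: "('a \<times> 'a) set \<Rightarrow> 'a set \<Rightarrow> nat list \<Rightarrow> nat" where
  "chrom_count R V [] = (if V = {} then 1 else 0)"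
| "chrom_count R V (c # cs) =
    (\<Sum>S | S \<subseteq> V \<and> card S = c. if stable R S then chrom_count R (V - S) cs else 0)"

lemma card_colorings_eq_chrom_count:
  assumes "finite V" "distinct xs" "set_mset M \<subseteq> set xs" "0 \<notin> set xs"
  shows "card (colorings V R M) = chrom_count R V (map (count M) xs)"
  using assms
proof (induction xs arbitrary: V M)
  case Nil
  then have M: "M = {#}" by simp
  have "colorings V R M = (if V = {} then {\<lambda>_. undefined} else {})"
    using \<open>finite V\<close> by (auto simp: colorings_def M mset_set_empty_iff)
  then show ?case by simp
next
  case (Cons x xs)
  define N where "N = filter_mset (\<lambda>y. y \<noteq> x) M"
  have M: "M = N + replicate_mset (count M x) x" by (auto simp: multiset_eq_iff N_def)
  have cN: "map (count M) xs = map (count N) xs" using Cons.prems(2) by (auto simp: N_def)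
  have "card (colorings V R M) = (\<Sum>S | S \<subseteq> V \<and> card S = count M x \<and> stable R S. card (colorings (V - S) R N))"
    by (subst M, rule colorings_branching) (use Cons.prems in \<open>auto simp: N_def Suc_le_eq\<close>)
  also have "\<dots> = (\<Sum>S | S \<subseteq> V \<and> card S = count M x. if stable R S then card (colorings (V - S) R N) else 0)"
    using Cons.prems(1) by (intro sum.mono_neutral_cong_left) auto
  also have "\<dots> = chrom_count R V (map (count M) (x # xs))"
    unfolding list.map chrom_count.simps cN
    using Cons.prems by (intro sum.cong refl if_cong Cons.IH) (auto simp: N_def)
  finally show ?case .
qed

text \<open>
  Symmetry in the form in which the recursion provides it: the coefficient of a monomial depends only on
  its list of exponents, not on the variables that carry them or on their order. Zero exponents are
  allowed in the lists.
\<close>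

definition symmetric_series :: "series \<Rightarrow> bool" where
  "symmetric_series f \<longleftrightarrow> (\<forall>M N xs ys. distinct xs \<longrightarrow> distinct ys \<longrightarrow> set_mset M \<subseteq> set xs \<longrightarrow> set_mset N \<subseteq> set ys \<longrightarrow>
     0 \<notin> set xs \<longrightarrow> 0 \<notin> set ys \<longrightarrow> map (count M) xs = map (count N) ys \<longrightarrow> f M = f N)"

lemma chromatic_sym_eq_chrom_count:
  assumes G: "pair_graph G" and xs: "distinct xs" "set_mset M \<subseteq> set xs" "0 \<notin> set xs"
  shows "chromatic_sym G M = of_nat (chrom_count (parcs G) (pverts G) (map (count M) xs))"
proof -
  interpret pair_graph G by fact
  show ?thesis using card_colorings_eq_chrom_count[OF _ xs, of "pverts G" "parcs G"]
    by (simp add: chromatic_sym_eq_card[OF G])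
qed

lemma symmetric_chromatic_sym: "pair_graph G \<Longrightarrow> symmetric_series (chromatic_sym G)"
  unfolding symmetric_series_def by (simp add: chromatic_sym_eq_chrom_count)

text \<open>
  The sublists with \<open>k\<close> elements, each paired with the list of the other elements.
\<close>

fun sublists_rest :: "nat \<Rightarrow> 'a list \<Rightarrow> ('a list \<times> 'a list) list" where
  "sublists_rest 0 vs = [([], vs)]"
| "sublists_rest (Suc k) [] = []"
| "sublists_rest (Suc k) (v # vs) =
    map (\<lambda>(s, r). (v # s, r)) (sublists_rest k vs) @ map (\<lambda>(s, r). (s, v # r)) (sublists_rest (Suc k) vs)"

fun chrom_list :: "('a \<Rightarrow> 'a \<Rightarrow> bool) \<Rightarrow> 'a list \<Rightarrow> nat list \<Rightarrow> nat" where
  "chrom_list adj vs [] = (if vs = [] then 1 else 0)"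
| "chrom_list adj vs (c # cs) =
    sum_list (map (\<lambda>(s, r). if list_all (\<lambda>u. list_all (\<lambda>v. \<not> adj u v) s) s then chrom_list adj r cs else 0)
      (sublists_rest c vs))"

lemma sum_subsets_of_card_0: "finite A \<Longrightarrow> (\<Sum>S | S \<subseteq> A \<and> card S = 0. f S) = f {}"
proof -
  assume A: "finite A"
  have "{S. S \<subseteq> A \<and> card S = 0} = {{}}" using finite_subset[OF _ A] by auto
  then show ?thesis by simp
qed

lemma sum_sublists_rest:
  "distinct vs \<Longrightarrow> (\<Sum>S | S \<subseteq> set vs \<and> card S = k. F S (set vs - S)) =
    sum_list (map (\<lambda>(s, r). F (set s) (set r)) (sublists_rest k vs))"
proof (induction k vs arbitrary: F rule: sublists_rest.induct)
  case (1 vs)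
  then show ?case by (simp add: sum_subsets_of_card_0 del: card_0_eq card_eq_0_iff)
next
  case (2 k)
  have "{S :: 'a set. S \<subseteq> set [] \<and> card S = Suc k} = {}" by auto
  then show ?case by (simp only: sum.empty) simp
next
  case (3 k v vs)
  have v: "v \<notin> set vs" and d: "distinct vs" using 3 by auto
  have "(\<Sum>S | S \<subseteq> set (v # vs) \<and> card S = Suc k. F S (set (v # vs) - S)) =
      (\<Sum>S | S \<subseteq> set vs \<and> card S = Suc k. F S (set (v # vs) - S)) +
      (\<Sum>S | S \<subseteq> set vs \<and> card S = k. F (insert v S) (set (v # vs) - insert v S))"
    unfolding list.set by (rule sum_subsets_insert) (use v in auto)
  also have "(\<Sum>S | S \<subseteq> set vs \<and> card S = Suc k. F S (set (v # vs) - S)) =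
      (\<Sum>S | S \<subseteq> set vs \<and> card S = Suc k. F S (insert v (set vs - S)))"
    using v by (intro sum.cong refl) (auto simp: insert_Diff_if)
  also have "\<dots> = sum_list (map (\<lambda>(s, r). F (set s) (insert v (set r))) (sublists_rest (Suc k) vs))"
    by (rule 3(2)[OF d])
  also have "(\<Sum>S | S \<subseteq> set vs \<and> card S = k. F (insert v S) (set (v # vs) - insert v S)) =
      (\<Sum>S | S \<subseteq> set vs \<and> card S = k. F (insert v S) (set vs - S))"
    using v by (intro sum.cong refl arg_cong[where f = "F _"]) auto
  also have "\<dots> = sum_list (map (\<lambda>(s, r). F (insert v (set s)) (set r)) (sublists_rest k vs))"
    by (rule 3(1)[OF d])
  finally show ?case by (simp add: comp_def split_def add.commute)
qed

lemma sublists_rest_distinct: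
  "distinct vs \<Longrightarrow> (s, r) \<in> set (sublists_rest k vs) \<Longrightarrow> distinct r \<and> set r \<subseteq> set vs"
proof (induction k vs arbitrary: s r rule: sublists_rest.induct)
  case (3 k v vs)
  have v: "v \<notin> set vs" "distinct vs" using 3(3) by auto
  consider s' where "(s', r) \<in> set (sublists_rest k vs)" | r' where "(s, r') \<in> set (sublists_rest (Suc k) vs)" "r = v # r'"
    using 3(4) by auto
  then show ?case
  proof cases
    case 1
    show ?thesis using 3(1)[OF v(2) 1] by auto
  next
    case 2
    show ?thesis using 3(2)[OF v(2) 2(1)] v 2(2) by auto
  qed
qed auto

lemma chrom_count_eq_chrom_list:
  "distinct vs \<Longrightarrow> chrom_count {(u, v). adj u v} (set vs) cs = chrom_list adj vs cs"
proof (induction cs arbitrary: vs)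
  case (Cons c cs)
  have "chrom_count {(u, v). adj u v} (set vs) (c # cs) =
      sum_list (map (\<lambda>(s, r). if stable {(u, v). adj u v} (set s) then chrom_count {(u, v). adj u v} (set r) cs else 0)
        (sublists_rest c vs))"
    unfolding chrom_count.simps
    by (rule sum_sublists_rest[where F = "\<lambda>S R. if stable {(u, v). adj u v} S then chrom_count {(u, v). adj u v} R cs else 0"])
       (rule Cons.prems)
  also have "\<dots> = chrom_list adj vs (c # cs)"
    unfolding chrom_list.simps
    using Cons.IH sublists_rest_distinct[OF Cons.prems]
    by (intro arg_cong[where f = sum_list] map_cong refl) (auto simp: stable_def list_all_iff)
  finally show ?case .
qed simp

text \<open>
  A coloring restricts to a coloring of the first graph and to an injection on the complete graph. The image
  \<open>S\<close> of that injection is a set of \<open>t\<close> colours, on which there are \<open>fact t\<close> injections.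
\<close>

lemma card_colorings_disjoint_complete:
  fixes V :: "'a set" and R :: "('a \<times> 'a) set" and t :: nat
  assumes V: "finite V"
  defines "U \<equiv> V <+> {..<t}"
  defines "R' \<equiv> map_prod Inl Inl ` R \<union> map_prod Inr Inr ` {(u, v). u < t \<and> v < t \<and> u \<noteq> v}"
  shows "card (colorings U R' M) = fact t * e_mult t (\<lambda>N. card (colorings V R N)) M"
proof -
  let ?I = "{S. S \<subseteq> set_mset M - {0} \<and> card S = t}"
  define B where "B S = {f \<in> {..<t} \<rightarrow>\<^sub>E S. inj_on f {..<t}}" for S :: "nat set"
  let ?P = "Sigma ?I (\<lambda>S. colorings V R (M - mset_set S) \<times> B S)"
  have finI: "finite S" if "S \<in> ?I" for S using that finite_subset[of S "set_mset M - {0}"] by auto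
  have cB: "card (B S) = fact t" if "S \<in> ?I" for S
    unfolding B_def using that card_inj_on_subset_funcset[of "{..<t}" S "{..<t}"] finI[OF that]
    by (simp add: fact_prod_rev)
  have finB: "finite (B S)" if "S \<in> ?I" for S
    using finI[OF that] finite_PiE[of "{..<t}" "\<lambda>_. S"] by (simp add: B_def)
  have B_onto: "b ` {..<t} = S" if "S \<in> ?I" "b \<in> B S" for S b
  proof (rule card_subset_eq[OF finI[OF that(1)]])
    show "b ` {..<t} \<subseteq> S" using that(2) by (auto simp: B_def)
    show "card (b ` {..<t}) = card S" using that by (simp add: B_def card_image)
  qed
  have Ums: "mset_set U = image_mset Inl (mset_set V) + image_mset Inr (mset_set {..<t})"
  proof -
    have "mset_set U = mset_set (Inl ` V) + mset_set (Inr ` {..<t})"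
      unfolding U_def Plus_def using V by (intro mset_set_Union) auto
    then show ?thesis by (simp add: image_mset_mset_set)
  qed
  have inj_iff: "(\<forall>u\<in>U. \<forall>v\<in>U. (u, v) \<in> R' \<longrightarrow> \<kappa> u \<noteq> \<kappa> v) \<longleftrightarrow>
      (\<forall>u\<in>V. \<forall>v\<in>V. (u, v) \<in> R \<longrightarrow> \<kappa> (Inl u) \<noteq> \<kappa> (Inl v)) \<and> inj_on (\<lambda>i. \<kappa> (Inr i)) {..<t}" for \<kappa> :: "'a + nat \<Rightarrow> nat"
  proof -
    have "(Inl u, Inl v) \<in> R' \<longleftrightarrow> (u, v) \<in> R" "(Inr i, Inr j) \<in> R' \<longleftrightarrow> i < t \<and> j < t \<and> i \<noteq> j"
      "(Inl u, Inr i) \<notin> R'" "(Inr i, Inl u) \<notin> R'" for u v i j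
      by (auto simp: R'_def)
    then show ?thesis by (simp add: U_def Plus_def ball_Un inj_on_def) blast
  qed
  define cut where "cut \<kappa> = ((\<lambda>i. \<kappa> (Inr i)) ` {..<t}, restrict (\<lambda>v. \<kappa> (Inl v)) V, restrict (\<lambda>i. \<kappa> (Inr i)) {..<t})"
    for \<kappa> :: "'a + nat \<Rightarrow> nat"
  define glue where "glue p = restrict (case_sum (fst (snd p)) (snd (snd p))) U"
    for p :: "nat set \<times> ('a \<Rightarrow> nat) \<times> (nat \<Rightarrow> nat)"
  have "bij_betw cut (colorings U R' M) ?P"
  proof (rule bij_betw_byWitness[where f' = "glue"])
    show "\<forall>\<kappa>\<in>colorings U R' M. glue (cut \<kappa>) = \<kappa>"
    proof
      fix \<kappa> assume \<kappa>: "\<kappa> \<in> colorings U R' M"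
      show "glue (cut \<kappa>) = \<kappa>"
      proof
        fix z
        show "glue (cut \<kappa>) z = \<kappa> z"
          using \<kappa> by (cases z) (auto simp: cut_def glue_def U_def colorings_def PiE_iff extensional_def)
      qed
    qed
    show "\<forall>p\<in>?P. cut (glue p) = p"
    proof
      fix p assume "p \<in> ?P"
      then obtain S a b where S: "S \<in> ?I" and a: "a \<in> colorings V R (M - mset_set S)" and b: "b \<in> B S"
        and p: "p = (S, a, b)" by blast
      have "restrict a V = a" "restrict b {..<t} = b"
        using a b by (simp_all add: colorings_def B_def PiE_iff extensional_restrict)
      moreover have "restrict (\<lambda>v. glue p (Inl v)) V = restrict a V"
        "restrict (\<lambda>i. glue p (Inr i)) {..<t} = restrict b {..<t}"
        "(\<lambda>i. glue p (Inr i)) ` {..<t} = b ` {..<t}"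
        by (auto simp: glue_def U_def p intro!: restrict_ext image_cong)
      ultimately show "cut (glue p) = p" using B_onto[OF S b] by (simp add: cut_def p)
    qed
    show "cut ` colorings U R' M \<subseteq> ?P"
    proof
      fix p assume "p \<in> cut ` colorings U R' M"
      then obtain \<kappa> where \<kappa>: "\<kappa> \<in> colorings U R' M" "p = cut \<kappa>" by blast
      let ?S = "(\<lambda>i. \<kappa> (Inr i)) ` {..<t}"
      have inj: "inj_on (\<lambda>i. \<kappa> (Inr i)) {..<t}"
        and proper: "\<forall>u\<in>V. \<forall>v\<in>V. (u, v) \<in> R \<longrightarrow> \<kappa> (Inl u) \<noteq> \<kappa> (Inl v)"
        using \<kappa>(1) inj_iff[of \<kappa>] by (auto simp: colorings_def)
      have M: "image_mset (\<lambda>v. \<kappa> (Inl v)) (mset_set V) + mset_set ?S = M"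
        using \<kappa>(1) inj by (simp add: colorings_def Ums image_mset_mset_set[symmetric] image_mset.compositionality comp_def)
      have pos: "\<kappa> z \<ge> 1" if "z \<in> U" for z using \<kappa>(1) that by (auto simp: colorings_def PiE_iff)
      have "?S \<subseteq> set_mset M" using M by (metis finite_imageI finite_lessThan finite_set_mset_mset_set set_mset_union sup_ge2)
      moreover have "0 \<notin> ?S" using pos by (force simp: U_def)
      ultimately have I: "?S \<in> ?I" using inj by (auto simp: card_image)
      have "image_mset (restrict (\<lambda>v. \<kappa> (Inl v)) V) (mset_set V) = image_mset (\<lambda>v. \<kappa> (Inl v)) (mset_set V)"
        using V by (intro image_mset_cong) auto
      then have "image_mset (restrict (\<lambda>v. \<kappa> (Inl v)) V) (mset_set V) = M - mset_set ?S" using M by auto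
      then have "restrict (\<lambda>v. \<kappa> (Inl v)) V \<in> colorings V R (M - mset_set ?S)"
        using proper pos by (auto simp: colorings_def U_def)
      moreover have "restrict (\<lambda>i. \<kappa> (Inr i)) {..<t} \<in> B ?S" using inj by (auto simp: B_def)
      ultimately show "p \<in> ?P" using I \<kappa>(2) by (simp add: cut_def)
    qed
    show "glue ` ?P \<subseteq> colorings U R' M"
    proof
      fix \<kappa> assume "\<kappa> \<in> glue ` ?P"
      then obtain S a b where S: "S \<in> ?I" and a: "a \<in> colorings V R (M - mset_set S)" and b: "b \<in> B S"
        and \<kappa>: "\<kappa> = glue (S, a, b)" by blast
      have e: "\<kappa> (Inl v) = a v" if "v \<in> V" for v using that by (auto simp: \<kappa> glue_def U_def)
      have e': "\<kappa> (Inr i) = b i" if "i < t" for i using that by (auto simp: \<kappa> glue_def U_def)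
      note bS = B_onto[OF S b]
      have "image_mset (\<lambda>v. \<kappa> (Inl v)) (mset_set V) = image_mset a (mset_set V)"
        using V by (intro image_mset_cong) (auto simp: e)
      moreover have "image_mset (\<lambda>i. \<kappa> (Inr i)) (mset_set {..<t}) = image_mset b (mset_set {..<t})"
        by (intro image_mset_cong) (auto simp: e')
      moreover have "image_mset b (mset_set {..<t}) = mset_set S"
        using b bS by (simp add: B_def image_mset_mset_set)
      moreover have "mset_set S \<subseteq># M"
        using S finI[OF S] by (auto simp: subseteq_mset_def count_mset_set' subset_iff Suc_le_eq)
      ultimately have "image_mset \<kappa> (mset_set U) = M"
        using a by (simp add: Ums image_mset.compositionality comp_def colorings_def subset_mset.diff_add)
      moreover have "\<kappa> \<in> U \<rightarrow>\<^sub>E {1..}"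
      proof (rule PiE_I)
        fix z assume "z \<in> U"
        then show "\<kappa> z \<in> {1..}"
          using a b S e e' by (auto simp: U_def colorings_def B_def PiE_iff Suc_le_eq intro!: gr0I)
      qed (simp add: \<kappa> glue_def)
      moreover have "\<forall>u\<in>V. \<forall>v\<in>V. (u, v) \<in> R \<longrightarrow> \<kappa> (Inl u) \<noteq> \<kappa> (Inl v)" using a e by (auto simp: colorings_def)
      moreover have "inj_on (\<lambda>i. \<kappa> (Inr i)) {..<t}" using b e' by (auto simp: B_def inj_on_def)
      ultimately show "\<kappa> \<in> colorings U R' M" using inj_iff[of \<kappa>] by (simp add: colorings_def)
    qed
  qed
  then have "card (colorings U R' M) = card ?P" by (rule bij_betw_same_card)
  also have "\<dots> = (\<Sum>S\<in>?I. card (colorings V R (M - mset_set S)) * fact t)"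
    using finB finite_colorings[OF V] cB by (subst card_SigmaI) (auto simp: card_cartesian_product)
  also have "\<dots> = fact t * e_mult t (\<lambda>N. card (colorings V R N)) M"
    by (simp add: e_mult_def sum_distrib_left mult.commute)
  finally show ?thesis .
qed

section \<open>Monotonicity under transfers and dominance\<close>

definition transfer_monotone :: "series \<Rightarrow> bool" where
  "transfer_monotone f \<longleftrightarrow> (\<forall>M i j. 0 < i \<longrightarrow> 0 < j \<longrightarrow> i \<noteq> j \<longrightarrow> count M j + 2 \<le> count M i \<longrightarrow>
     f M \<le> f (M - {#i#} + {#j#}))"


lemma symmetric_swap:
  assumes f: "symmetric_series f" and 0: "0 \<notin># M" "0 \<notin># N" and ij: "i \<noteq> j" "0 < i" "0 < j"
    and c: "count N i = count M j" "count N j = count M i" "\<And>x. x \<noteq> i \<Longrightarrow> x \<noteq> j \<Longrightarrow> count N x = count M x"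
  shows "f M = f N"
proof -
  define rs where "rs = sorted_list_of_set ((set_mset M \<union> set_mset N) - {i, j})"
  have rs: "distinct rs" "set rs = (set_mset M \<union> set_mset N) - {i, j}" by (auto simp: rs_def)
  have "map (count M) (i # j # rs) = map (count N) (j # i # rs)" using c rs by auto
  moreover have "distinct (i # j # rs)" "distinct (j # i # rs)" using rs ij by auto
  moreover have "set_mset M \<subseteq> set (i # j # rs)" "set_mset N \<subseteq> set (j # i # rs)" using rs by auto
  moreover have "0 \<notin> set (i # j # rs)" "0 \<notin> set (j # i # rs)" using rs ij 0 by auto
  ultimately show ?thesis using f unfolding symmetric_series_def by blast
qed

text \<open>
  Write \<open>a\<close> and \<open>b\<close> for the exponents of \<open>i\<close> and \<open>j\<close>, so that \<open>a \<ge> b + 2\<close>, and match a set \<open>S\<close> of variables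
  in the expansion of \<open>e_mult t f M\<close> with its image under the exchange of \<open>i\<close> and \<open>j\<close>. If \<open>S\<close> contains both
  or neither, the matched monomials differ by one transfer. If it contains only \<open>i\<close>, they are equal. If it
  contains only \<open>j\<close>, the exponents change from \<open>(a, b - 1)\<close> to \<open>(a - 2, b + 1)\<close>, which are two transfers, unless
  \<open>a = b + 2\<close>: then one transfer leads to \<open>(b + 1, b)\<close>, and symmetry does the rest.
\<close>

lemma transfer_monotone_e_mult:
  assumes f: "transfer_monotone f" and sym: "symmetric_series f" and nonneg: "\<And>M. f M \<ge> 0"
    and zero: "\<And>M. 0 \<in># M \<Longrightarrow> f M = 0"
  shows "transfer_monotone (e_mult t f)"
  unfolding transfer_monotone_def
proof (intro allI impI)
  fix M :: "nat multiset" and i j :: nat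
  assume i: "0 < i" and j: "0 < j" and ij: "i \<noteq> j" and ge: "count M j + 2 \<le> count M i"
  let ?M' = "M - {#i#} + {#j#}" and ?\<tau> = "transpose i j"
  let ?I = "{S. S \<subseteq> set_mset M - {0} \<and> card S = t}" and ?I' = "{S. S \<subseteq> set_mset ?M' - {0} \<and> card S = t}"
  have step: "f N \<le> f (N - {#i#} + {#j#})" if "count N j + 2 \<le> count N i" for N
    using f i j ij that unfolding transfer_monotone_def by blast
  have iM: "i \<in># M" using ge by (metis add_is_0 count_eq_zero_iff le_zero_eq zero_neq_numeral)
  have setM': "set_mset ?M' = insert j (set_mset M)"
  proof -
    have "x \<in># ?M' \<longleftrightarrow> x \<in> insert j (set_mset M)" for x
      using ge ij by (cases "x = i") (auto simp: count_greater_zero_iff[symmetric] simp del: count_greater_zero_iff)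
    then show ?thesis by blast
  qed
  have le: "f (M - mset_set S) \<le> f (?M' - mset_set (?\<tau> ` S))" if S: "S \<in> ?I" for S
  proof -
    have fin: "finite S" using S finite_subset[of S "set_mset M - {0}"] by auto
    define N where "N = M - mset_set S"
    define N' where "N' = ?M' - mset_set (?\<tau> ` S)"
    have mem: "x \<in> ?\<tau> ` S \<longleftrightarrow> ?\<tau> x \<in> S" for x
      by (metis image_iff transpose_involutory)
    have cN: "count N x = count M x - of_bool (x \<in> S)" for x
      using fin by (simp add: N_def count_mset_set')
    have cN': "count N' x = count ?M' x - of_bool (?\<tau> x \<in> S)" for x
      using fin by (simp add: N'_def count_mset_set' mem)
    have pos: "count M x \<ge> 1" if "x \<in> S" for x using S that by (auto simp: Suc_le_eq)
    have other: "count N' x = count N x" if "x \<noteq> i" "x \<noteq> j" for x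
      using that by (simp add: cN cN')
    consider (same) "i \<in> S \<longleftrightarrow> j \<in> S" | (i) "i \<in> S" "j \<notin> S" | (j) "j \<in> S" "i \<notin> S" by blast
    then have "f N \<le> f N'"
    proof cases
      case same
      have "count N' x = count (N - {#i#} + {#j#}) x" for x
        using same ij pos ge by (cases "x = i"; cases "x = j") (auto simp: cN cN' of_bool_def)
      then have "N' = N - {#i#} + {#j#}" by (rule multiset_eqI)
      moreover have "count N j + 2 \<le> count N i" using same ge pos[of j] by (auto simp: cN of_bool_def)
      ultimately show ?thesis using step by simp
    next
      case i
      have "count N' x = count N x" for x
        using i ij ge other[of x] by (cases "x = i"; cases "x = j") (auto simp: cN cN')
      then have "N' = N" by (rule multiset_eqI)
      then show ?thesis by simp
    next
      case j
      define K where "K = N - {#i#} + {#j#}"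
      have b: "count M j \<ge> 1" using pos j by blast
      have K: "count K i = count M i - 1" "count K j = count M j" "x \<noteq> i \<Longrightarrow> x \<noteq> j \<Longrightarrow> count K x = count N x" for x
        using j b ij by (auto simp: K_def cN)
      have N': "count N' i = count M i - 2" "count N' j = count M j + 1"
        using j b ij by (auto simp: cN')
      have "f N \<le> f K" unfolding K_def by (rule step) (use j ge in \<open>simp add: cN\<close>)
      also have "f K \<le> f N'"
      proof (cases "count M i = count M j + 2")
        case True
        show ?thesis
        proof (cases "0 \<in># M")
          case True
          then have "0 \<in># K" using K(3)[of 0] S \<open>0 < i\<close> \<open>0 < j\<close> cN[of 0] by (auto simp: count_greater_zero_iff[symmetric] simp del: count_greater_zero_iff)
          then show ?thesis using zero nonneg by simp
        next
          case False
          have "count K 0 = 0" "count N' 0 = 0"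
            using K(3)[of 0] other[of 0] cN[of 0] False \<open>0 < i\<close> \<open>0 < j\<close> by (simp_all add: not_in_iff)
          then have "0 \<notin># K" "0 \<notin># N'" by (simp_all add: not_in_iff)
          then have "f K = f N'"
            using K N' True other \<open>i \<noteq> j\<close> \<open>0 < i\<close> \<open>0 < j\<close>
            by (intro symmetric_swap[OF sym, of K N' i j]) auto
          then show ?thesis by simp
        qed
      next
        case False
        have "count N' x = count (K - {#i#} + {#j#}) x" for x
          using K N' other[of x] ij by (cases "x = i"; cases "x = j") auto
        then have "N' = K - {#i#} + {#j#}" by (rule multiset_eqI)
        moreover have "count K j + 2 \<le> count K i" using False ge K by simp
        ultimately show ?thesis using step by simp
      qed
      finally show ?thesis .
    qed
    then show ?thesis by (simp add: N_def N'_def)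
  qed
  have inj: "inj_on ((`) ?\<tau>) ?I" by (simp add: inj_on_def inj_image_eq_iff[OF inj_transpose])
  have sub: "(`) ?\<tau> ` ?I \<subseteq> ?I'"
  proof safe
    fix S x assume S: "S \<subseteq> set_mset M - {0}" and x: "x \<in> S"
    then show "?\<tau> x \<in># ?M'" using iM unfolding setM' by (auto simp: transpose_def)
    assume "?\<tau> x = 0" then show False using S x i j by (auto simp: transpose_def split: if_splits)
  qed (simp add: card_image inj_on_transpose)
  have "e_mult t f M \<le> (\<Sum>S\<in>?I. f (?M' - mset_set (?\<tau> ` S)))"
    unfolding e_mult_def by (rule sum_mono) (rule le)
  also have "\<dots> = (\<Sum>S\<in>(`) ?\<tau> ` ?I. f (?M' - mset_set S))" by (simp add: sum.reindex[OF inj])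
  also have "\<dots> \<le> e_mult t f ?M'" unfolding e_mult_def by (rule sum_mono2[OF _ sub]) (auto simp: nonneg)
  finally show "e_mult t f M \<le> e_mult t f ?M'" .
qed

text \<open>
  Dominance is generated by transfers. Let \<open>j\<close> be the first index at which \<open>M\<close> falls below \<open>N\<close>; by dominance
  \<open>M\<close> exceeds \<open>N\<close> at some earlier index \<open>i\<close>. As \<open>N\<close> decreases weakly, the exponents of \<open>M\<close> at \<open>i\<close> and \<open>j\<close> differ
  by at least two. The transfer between them keeps the prefix sums above those of \<open>N\<close>, since the inequality
  between the prefix sums was strict from \<open>i\<close> to \<open>j\<close>, and it shrinks \<open>M - N\<close>. The
  induction runs over all monomials \<open>M\<close> because a transfer may destroy the order of the exponents.
\<close>

lemma transfer_monotone_dominance: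
  assumes f: "transfer_monotone f"
  shows "size M = size N \<Longrightarrow> 0 \<notin># M \<Longrightarrow> 0 \<notin># N \<Longrightarrow> antimono (\<lambda>i. count N (Suc i)) \<Longrightarrow>
    (\<And>k. (\<Sum>i<k. count N (Suc i)) \<le> (\<Sum>i<k. count M (Suc i))) \<Longrightarrow> f M \<le> f N"
proof (induction "size (M - N)" arbitrary: M rule: less_induct)
  case less
  note N = \<open>antimono (\<lambda>i. count N (Suc i))\<close>
  show ?case
  proof (cases "M = N")
    case False
    have "\<exists>x. count M x < count N x"
    proof (rule ccontr)
      assume "\<nexists>x. count M x < count N x"
      then have "N \<subseteq># M" by (auto simp: subseteq_mset_def not_less)
      then show False using less.prems(1) False by (metis mset_subset_size nat_neq_iff subset_mset.le_imp_less_or_eq)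
    qed
    then obtain x where x: "count M x < count N x" by blast
    then have "x \<noteq> 0" using less.prems(3) by (metis count_eq_zero_iff less_nat_zero_code)
    then have ex: "\<exists>j. count M (Suc j) < count N (Suc j)" using x by (metis not0_implies_Suc)
    define j where "j = (LEAST j. count M (Suc j) < count N (Suc j))"
    have j: "count M (Suc j) < count N (Suc j)" unfolding j_def by (rule LeastI_ex[OF ex])
    have before: "count N (Suc l) \<le> count M (Suc l)" if "l < j" for l
      using not_less_Least[of l "\<lambda>j. count M (Suc j) < count N (Suc j)"] that by (simp add: j_def not_less)
    have "\<exists>i<j. count N (Suc i) < count M (Suc i)"
    proof (rule ccontr)
      assume "\<not> (\<exists>i<j. count N (Suc i) < count M (Suc i))"
      then have "(\<Sum>i<j. count M (Suc i)) \<le> (\<Sum>i<j. count N (Suc i))" by (intro sum_mono) (meson lessThan_iff not_less)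
      then show False using less.prems(5)[of "Suc j"] j by simp
    qed
    then obtain i where i: "i < j" "count N (Suc i) < count M (Suc i)" by blast
    let ?M' = "M - {#Suc i#} + {#Suc j#}"
    have iM: "Suc i \<in># M" using i(2) by (auto simp: count_greater_zero_iff[symmetric] simp del: count_greater_zero_iff)
    have "count N (Suc j) \<le> count N (Suc i)" using antimonoD[OF N, of i j] i(1) by simp
    then have "f M \<le> f ?M'" using f i j unfolding transfer_monotone_def by force
    also have "f ?M' \<le> f N"
    proof (rule less.hyps)
      have "count (?M' - N) x = count (M - N - {#Suc i#}) x" for x using i j by auto
      then have eq: "?M' - N = M - N - {#Suc i#}" by (rule multiset_eqI)
      have "Suc i \<in># M - N" using i(2) by (auto simp: count_greater_zero_iff[symmetric] simp del: count_greater_zero_iff)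
      then show "size (?M' - N) < size (M - N)" unfolding eq by (rule size_Diff1_less)
      show "size ?M' = size N" using less.prems(1) iM by (simp add: size_Diff_singleton) (metis Suc_pred iM nonempty_has_size set_mset_empty empty_iff)
      show "0 \<notin># ?M'" using less.prems(2) by (auto dest: in_diffD)
      show "(\<Sum>l<k. count N (Suc l)) \<le> (\<Sum>l<k. count ?M' (Suc l))" for k
      proof -
        have "int (\<Sum>l<k. count ?M' (Suc l)) = (\<Sum>l<k. int (count M (Suc l)) - of_bool (l = i) + of_bool (l = j))"
          using i by (simp add: of_nat_diff, intro sum.cong refl) (auto simp: of_nat_diff)
        also have "\<dots> = int (\<Sum>l<k. count M (Suc l)) - of_bool (i < k) + of_bool (j < k)"
          by (simp add: sum.distrib sum_subtractf of_bool_def sum.delta')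
        finally have shift: "int (\<Sum>l<k. count ?M' (Suc l)) =
          int (\<Sum>l<k. count M (Suc l)) - of_bool (i < k) + of_bool (j < k)" .
        show ?thesis
        proof (cases "i < k \<and> k \<le> j")
          case True
          then have "(\<Sum>l<k. count N (Suc l)) < (\<Sum>l<k. count M (Suc l))"
            using i before by (intro sum_strict_mono_ex1) auto
          moreover have "of_bool (i < k) = (1 :: int)" "of_bool (j < k) = (0 :: int)" using True by auto
          ultimately show ?thesis using shift by linarith
        next
          case False
          then have "of_bool (i < k) = (of_bool (j < k) :: int)" using i(1) by auto
          then show ?thesis using shift less.prems(5)[of k] by linarith
        qed
      qed
    qed (use less.prems in auto)
    finally show ?thesis .
  qed simp
qed

lemma transfer_monotone_canon:
  assumes f: "transfer_monotone f" and \<nu>: "\<nu> \<in> partitions_of n" and \<mu>: "\<mu> \<in> partitions_of n" and d: "dominance_ge \<nu> \<mu>"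
  shows "f (canon \<nu>) \<le> f (canon \<mu>)"
proof (rule transfer_monotone_dominance[OF f])
  show "antimono (\<lambda>i. count (canon \<mu>) (Suc i))"
    using ptn_shape_partition[of \<mu>] \<mu> by (simp add: partitions_of_def ptn_def)
qed (use \<nu> \<mu> d in \<open>auto simp: partitions_of_def dominance_ge_iff count_eq_zero_iff[symmetric] simp del: count_eq_zero_iff\<close>)

lemma type_canon:
  assumes "is_partition \<mu>"
  shows "image_mset (count (canon \<mu>)) (mset_set (set_mset (canon \<mu>))) = mset \<mu>"
proof -
  have "set_mset (canon \<mu>) = Suc ` {..<length \<mu>}"
  proof
    show "Suc ` {..<length \<mu>} \<subseteq> set_mset (canon \<mu>)"
    proof safe
      fix i assume "i < length \<mu>"
      then have "count (canon \<mu>) (Suc i) \<noteq> 0"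
        using assms nth_mem[of i \<mu>] unfolding is_partition_def by (metis count_canon_Suc nth_default_nth)
      then show "Suc i \<in># canon \<mu>" by (metis count_eq_zero_iff)
    qed
  qed (rule set_canon)
  then have "mset_set (set_mset (canon \<mu>)) = image_mset Suc (mset_set {..<length \<mu>})"
    by (simp add: image_mset_mset_set)
  then have "image_mset (count (canon \<mu>)) (mset_set (set_mset (canon \<mu>))) = image_mset (shape \<mu>) (mset_set {..<length \<mu>})"
    by (simp add: image_mset.compositionality comp_def)
  also have "\<dots> = image_mset ((!) \<mu>) (mset_set {..<length \<mu>})"
    by (rule image_mset_cong) (simp add: nth_default_def)
  also have "\<dots> = mset (map ((!) \<mu>) [0..<length \<mu>])" by (simp add: atLeast0LessThan)
  also have "\<dots> = mset \<mu>" by (simp only: map_nth)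
  finally show ?thesis .
qed

lemma partition_mset_inject:
  assumes "is_partition \<nu>" "is_partition \<mu>" "mset \<nu> = mset \<mu>" shows "\<nu> = \<mu>"
proof -
  have "sorted (rev \<nu>)" "sorted (rev \<mu>)" using assms by (auto simp: is_partition_def sorted_wrt_rev)
  then have "rev \<nu> = rev \<mu>" using assms(3) by (metis mset_rev properties_for_sort)
  then show ?thesis by simp
qed

lemma finite_partitions_of: "finite (partitions_of n)"
proof (rule finite_subset)
  show "partitions_of n \<subseteq> {\<nu>. set \<nu> \<subseteq> {..n} \<and> length \<nu> \<le> n}"
  proof
    fix \<nu> assume \<nu>: "\<nu> \<in> partitions_of n"
    have "length \<xi> \<le> sum_list \<xi>" if "0 \<notin> set \<xi>" for \<xi> :: "nat list"
      using that by (induction \<xi>) (auto simp: Suc_le_eq)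
    then show "\<nu> \<in> {\<nu>. set \<nu> \<subseteq> {..n} \<and> length \<nu> \<le> n}"
      using \<nu> member_le_sum_list[of _ \<nu>] by (auto simp: partitions_of_def is_partition_def)
  qed
qed (simp add: finite_lists_length_le)

lemma sum_list_counts:
  assumes "distinct xs" "set_mset M \<subseteq> set xs" shows "sum_list (map (count M) xs) = size M"
  using assms by (simp add: sum_list_distinct_conv_sum_set size_multiset_overloaded_eq sum.mono_neutral_right count_eq_zero_iff)

lemma counts_nonzero:
  assumes "set xs \<subseteq> set_mset M" shows "0 \<notin> set (map (count M) xs)"
proof
  assume "0 \<in> set (map (count M) xs)"
  then obtain x where "x \<in># M" "0 = count M x" using assms by auto
  then show False by (metis count_eq_zero_iff)
qed

text \<open>
  A symmetric series that is homogeneous of degree \<open>n\<close> is the sum of the monomial symmetric functions weighted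
  with its coefficients at the monomials with sorted exponents.
\<close>

lemma basis_coeff_monomial:
  assumes sym: "symmetric_series f" and hom: "\<And>M. size M \<noteq> n \<or> 0 \<in># M \<Longrightarrow> f M = 0"
    and \<nu>: "\<nu> \<in> partitions_of n"
  shows "basis_coeff monomial_sym \<nu> f = f (canon \<nu>)"
proof -
  have "basis_coeff monomial_sym \<nu> f = (if \<nu> \<in> partitions_of n then f (canon \<nu>) else 0)"
  proof (rule basis_coeff_triangular[where A = "partitions_of n" and c = "\<lambda>\<nu>. f (canon \<nu>)"])
    show "dominance_ge \<xi> \<mu>" if "is_partition \<xi>" "is_partition \<mu>" "monomial_sym \<xi> (canon \<mu>) \<noteq> 0" for \<xi> \<mu>
    proof -
      have "\<xi> = \<mu>" using that type_canon[of \<mu>] by (intro partition_mset_inject) (auto simp: monomial_sym_def split: if_splits)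
      then show ?thesis by (simp add: dominance_ge_def)
    qed
    show "monomial_sym \<xi> (canon \<xi>) \<noteq> 0" if "is_partition \<xi>" for \<xi>
      using type_canon[OF that] set_canon[of \<xi>] by (auto simp: monomial_sym_def)
    show "f M = (\<Sum>\<nu>\<in>partitions_of n. f (canon \<nu>) * monomial_sym \<nu> M)" for M
    proof (cases "size M = n \<and> 0 \<notin># M")
      case False
      have "monomial_sym \<xi> M = 0" if "\<xi> \<in> partitions_of n" for \<xi>
      proof (rule ccontr)
        assume "monomial_sym \<xi> M \<noteq> 0"
        then have *: "set_mset M \<subseteq> {1..}" "image_mset (count M) (mset_set (set_mset M)) = mset \<xi>"
          by (auto simp: monomial_sym_def split: if_splits)
        have "size M = sum_mset (image_mset (count M) (mset_set (set_mset M)))"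
          by (simp add: size_multiset_overloaded_eq sum_unfold_sum_mset)
        also have "\<dots> = n" using that *(2) by (simp add: sum_mset_sum_list partitions_of_def)
        finally show False using False *(1) by auto
      qed
      then show ?thesis using False hom[of M] by (auto intro: sum.neutral[symmetric])
    next
      case True
      define xs where "xs = rev (sort_key (count M) (sorted_list_of_set (set_mset M)))"
      have xs: "distinct xs" "set xs = set_mset M" by (auto simp: xs_def)
      define \<xi> where "\<xi> = map (count M) xs"
      have "sorted_wrt (\<ge>) \<xi>" by (simp add: \<xi>_def xs_def rev_map[symmetric] sorted_wrt_rev)
      moreover have "0 \<notin> set \<xi>" unfolding \<xi>_def by (rule counts_nonzero) (simp add: xs)
      moreover have content: "image_mset (count M) (mset_set (set_mset M)) = mset \<xi>"
        using xs by (simp add: \<xi>_def mset_set_set[symmetric])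
      moreover have "sum_list \<xi> = n"
        using True sum_list_counts[OF xs(1), of M] xs(2) by (simp add: \<xi>_def)
      ultimately have \<xi>: "\<xi> \<in> partitions_of n" by (simp add: partitions_of_def is_partition_def)
      have "monomial_sym \<mu> M = (if \<mu> = \<xi> then 1 else 0)" if "\<mu> \<in> partitions_of n" for \<mu>
        using that \<xi> True content partition_mset_inject[of \<mu> \<xi>]
        by (auto simp: monomial_sym_def partitions_of_def Suc_le_eq intro!: gr0I)
      then have "(\<Sum>\<nu>\<in>partitions_of n. f (canon \<nu>) * monomial_sym \<nu> M) =
          (\<Sum>\<nu>\<in>partitions_of n. if \<nu> = \<xi> then f (canon \<xi>) else 0)"
        by (intro sum.cong) auto
      also have "\<dots> = f (canon \<xi>)" using \<xi> by (simp add: finite_partitions_of)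
      also have "f M = f (canon \<xi>)"
      proof -
        let ?ys = "map Suc [0..<length \<xi>]"
        have "map (count (canon \<xi>)) ?ys = map (shape \<xi>) [0..<length \<xi>]" by simp
        also have "\<dots> = \<xi>" by (rule nth_equalityI) (auto simp: nth_default_def)
        finally have "map (count M) xs = map (count (canon \<xi>)) ?ys" by (simp add: \<xi>_def)
        moreover have "distinct ?ys" by (simp add: distinct_map)
        moreover have "set_mset (canon \<xi>) \<subseteq> set ?ys" using set_canon[of \<xi>] by (simp add: atLeast0LessThan)
        moreover have "0 \<notin> set ?ys" by auto
        moreover have "0 \<notin> set xs" "set_mset M \<subseteq> set xs" using xs True by auto
        ultimately show ?thesis using sym xs(1) unfolding symmetric_series_def by blast
      qed
      finally show ?thesis by simp
    qed
  qed (use \<nu> finite_partitions_of in \<open>auto simp: partitions_of_def\<close>)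
  then show ?thesis using \<nu> by simp
qed

section \<open>The chromatic symmetric function of the bipartite component\<close>

fun adjH :: "nat + nat \<Rightarrow> nat + nat \<Rightarrow> bool" where
  "adjH (Inl i) (Inr j) \<longleftrightarrow> i < 3 \<and> j < 3 \<and> \<not> (i = 0 \<and> j = 0)"
| "adjH (Inr j) (Inl i) \<longleftrightarrow> i < 3 \<and> j < 3 \<and> \<not> (i = 0 \<and> j = 0)"
| "adjH _ _ \<longleftrightarrow> False"

definition vertsH :: "(nat + nat) list" where
  "vertsH = [Inl 0, Inl 1, Inl 2, Inr 0, Inr 1, Inr 2]"

text \<open>
  A composition of \<open>Suc n\<close> arises from one of \<open>n\<close> by a new first part 1 or by an increment of the first part.
\<close>

fun compositions :: "nat \<Rightarrow> nat list list" where
  "compositions 0 = [[]]"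
| "compositions (Suc n) = map ((#) 1) (compositions n) @
     map (\<lambda>c. Suc (hd c) # tl c) (filter (\<lambda>c. c \<noteq> []) (compositions n))"

lemma mem_compositions: "0 \<notin> set c \<Longrightarrow> c \<in> set (compositions (sum_list c))"
proof (induction "sum_list c" arbitrary: c)
  case 0
  then show ?case by (cases c) auto
next
  case (Suc n)
  obtain a cs where a: "c = a # cs" using Suc.hyps(2) by (metis list.exhaust nat.distinct(1) sum_list.Nil)
  then obtain b where b: "a = Suc b" using Suc.prems by (cases a) auto
  note c = a[unfolded b]
  show ?case
  proof (cases b)
    case 0
    then show ?thesis using Suc(1)[of cs] Suc(2,3) c by auto
  next
    case (Suc b')
    then have "b # cs \<in> set (compositions n)" using Suc.hyps(1)[of "b # cs"] Suc.hyps(2) Suc.prems c by auto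
    then show ?thesis using Suc.hyps(2)[symmetric] c by (force simp: image_iff)
  qed
qed

abbreviation chromH :: "nat list \<Rightarrow> nat" where
  "chromH \<equiv> chrom_list adjH vertsH"

text \<open>
  The Schur expansion at one list of exponents, with the term of the shape $222$ moved to the left so that
  all numbers are natural. A constant of its own keeps the evaluation from entering the identity before the
  list is known.
\<close>

definition schur_identity_at :: "nat list \<Rightarrow> bool" where
  "schur_identity_at c \<longleftrightarrow> chromH c + 4 * kostka_list [2,2,2] c =
     2 * kostka_list [3,3] c + 4 * kostka_list [3,2,1] c + 2 * kostka_list [3,1,1,1] c
     + 26 * kostka_list [2,2,1,1] c + 52 * kostka_list [2,1,1,1,1] c + 152 * kostka_list [1,1,1,1,1,1] c"

lemma chromH_schur: "list_all schur_identity_at (compositions 6)"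
  by code_simp

definition transfer_at :: "nat \<Rightarrow> nat \<Rightarrow> nat list \<Rightarrow> bool" where
  "transfer_at a b r \<longleftrightarrow> chromH (a # b # r) \<le> chromH ((a - 1) # Suc b # r)"

lemma chromH_transfer:
  "list_all (\<lambda>(a, b). list_all (transfer_at a b) (compositions (6 - a - b)))
    [(2,0), (3,0), (3,1), (4,0), (4,1), (4,2), (5,0), (5,1), (6,0)]"
  by code_simp

lemma pair_graph_H: "pair_graph K33_minus_edge"
  unfolding K33_minus_edge_def
  by (intro pair_graph_del_edge pair_graphI_complete_bipartite[OF complete_bipartite_graph_correct])

lemma parcs_H: "parcs K33_minus_edge = {(u, v). adjH u v}"
proof -
  have "(u, v) \<in> parcs K33_minus_edge \<longleftrightarrow> adjH u v" for u v
    by (cases u; cases v) (auto simp: K33_minus_edge_def del_edge_def complete_bipartite_graph_def)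
  then show ?thesis by auto
qed

lemma pverts_H: "pverts K33_minus_edge = set vertsH"
  by (auto simp: K33_minus_edge_def del_edge_def complete_bipartite_graph_def vertsH_def Plus_def
      lessThan_nat_numeral lessThan_Suc numeral_3_eq_3)

lemma distinct_vertsH: "distinct vertsH"
  by (simp add: vertsH_def)

lemma chromatic_sym_H:
  assumes "distinct xs" "set_mset M \<subseteq> set xs" "0 \<notin> set xs"
  shows "chromatic_sym K33_minus_edge M = of_nat (chromH (map (count M) xs))"
  using chromatic_sym_eq_chrom_count[OF pair_graph_H assms]
  by (simp add: parcs_H pverts_H chrom_count_eq_chrom_list[OF distinct_vertsH])

lemma chromatic_sym_eq_0:
  assumes "pair_graph G" "size M \<noteq> card (pverts G) \<or> 0 \<in># M"
  shows "chromatic_sym G M = 0"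
proof -
  interpret pair_graph G by fact
  have "colorings (pverts G) (parcs G) M = {}" 
    using assms(2) colorings_content[where V = "pverts G" and R = "parcs G" and M = M] by auto
  then show ?thesis by (simp add: chromatic_sym_eq_card[OF assms(1)])
qed

lemma card_verts_H: "card (pverts K33_minus_edge) = 6"
  by (simp add: pverts_H vertsH_def)

lemma schur_eq_0:
  assumes "is_partition \<nu>" "size M \<noteq> sum_list \<nu> \<or> 0 \<in># M"
  shows "schur \<nu> M = 0"
proof -
  have "tableaux (shape \<nu>) M = {}"
    using assms tableaux_size[of _ "shape \<nu>" M] tableaux_pos[OF ptn_shape_partition[OF assms(1)], of _ M]
      card_young_shape[of \<nu>] by fastforce
  then show ?thesis by (simp add: schur_eq_kostka)
qed

text \<open>
  Shapes and coefficients of the Schur expansion of $X_H$.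
\<close>

definition H_terms :: "(nat list \<times> int) list" where
  "H_terms = [([3,3], 2), ([3,2,1], 4), ([3,1,1,1], 2), ([2,2,2], -4), ([2,2,1,1], 26),
     ([2,1,1,1,1], 52), ([1,1,1,1,1,1], 152)]"

lemma H_terms_partition: "(\<nu>, c) \<in> set H_terms \<Longrightarrow> is_partition \<nu> \<and> sum_list \<nu> = 6"
  by (auto simp: H_terms_def is_partition_def)

text \<open>
  Both sides are computed by removing the colours of \<open>M\<close> from the largest to the smallest, so they depend
  only on the composition of 6 formed by the exponents in that order.
\<close>

lemma chromatic_sym_H_schur:
  "chromatic_sym K33_minus_edge M = (\<Sum>(\<nu>, c)\<leftarrow>H_terms. of_int c * schur \<nu> M)"
proof (cases "size M = 6 \<and> 0 \<notin># M")
  case False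
  then have "chromatic_sym K33_minus_edge M = 0"
    using chromatic_sym_eq_0[OF pair_graph_H] card_verts_H by auto
  moreover have "schur \<nu> M = 0" if "(\<nu>, c) \<in> set H_terms" for \<nu> c
    using H_terms_partition[OF that] schur_eq_0[of \<nu> M] False by auto
  then have "map (\<lambda>(\<nu>, c). of_int c * schur \<nu> M) H_terms = map (\<lambda>_. 0) H_terms" by auto
  then have "(\<Sum>(\<nu>, c)\<leftarrow>H_terms. of_int c * schur \<nu> M) = (\<Sum>_\<leftarrow>H_terms. 0)" by (simp only:)
  ultimately show ?thesis by simp
next
  case True
  define xs where "xs = rev (sorted_list_of_set (set_mset M))"
  have xs: "distinct xs" "set xs = set_mset M" "sorted_wrt (>) xs"
    by (auto simp: xs_def sorted_wrt_rev)
  define c where "c = map (count M) xs"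
  have "0 \<notin> set c" unfolding c_def by (rule counts_nonzero) (simp add: xs)
  moreover have "sum_list c = 6" using sum_list_counts[OF xs(1), of M] True xs(2) by (simp add: c_def)
  ultimately have "c \<in> set (compositions 6)" using mem_compositions by metis
  then have "chromH c + 4 * kostka_list [2,2,2] c =
     2 * kostka_list [3,3] c + 4 * kostka_list [3,2,1] c + 2 * kostka_list [3,1,1,1] c
     + 26 * kostka_list [2,2,1,1] c + 52 * kostka_list [2,1,1,1,1] c + 152 * kostka_list [1,1,1,1,1,1] c"
    using chromH_schur unfolding list_all_iff schur_identity_at_def by blast
  then have "rat_of_nat (chromH c + 4 * kostka_list [2,2,2] c) = rat_of_nat (
     2 * kostka_list [3,3] c + 4 * kostka_list [3,2,1] c + 2 * kostka_list [3,1,1,1] c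
     + 26 * kostka_list [2,2,1,1] c + 52 * kostka_list [2,1,1,1,1] c + 152 * kostka_list [1,1,1,1,1,1] c)"
    by (simp only:)
  moreover have "chromatic_sym K33_minus_edge M = of_nat (chromH c)"
    unfolding c_def by (rule chromatic_sym_H) (use xs True in auto)
  moreover have "schur \<nu> M = of_nat (kostka_list \<nu> c)" if "is_partition \<nu>" for \<nu>
    unfolding schur_eq_kostka c_def
    by (rule arg_cong[OF kostka_eq_kostka_list[OF ptn_shape_partition[OF that] xs(3)]])
       (use xs(2) True in \<open>auto simp: Suc_le_eq intro!: gr0I\<close>)
  ultimately show ?thesis by (simp add: H_terms_def is_partition_def)
qed

text \<open>
  The recursion for colorings may begin with the colours \<open>i\<close> and \<open>j\<close>. It remains to compare two numbers for
  each pair of multiplicities of \<open>i\<close> and \<open>j\<close> and each composition formed by the other multiplicities.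
\<close>

lemma transfer_monotone_H: "transfer_monotone (chromatic_sym K33_minus_edge)"
  unfolding transfer_monotone_def
proof (intro allI impI)
  fix M :: "nat multiset" and i j :: nat
  assume ij: "0 < i" "0 < j" "i \<noteq> j" and ge: "count M j + 2 \<le> count M i"
  let ?M' = "M - {#i#} + {#j#}"
  show "chromatic_sym K33_minus_edge M \<le> chromatic_sym K33_minus_edge ?M'"
  proof (cases "size M = 6 \<and> 0 \<notin># M")
    case False
    then have "chromatic_sym K33_minus_edge M = 0"
      using chromatic_sym_eq_0[OF pair_graph_H] card_verts_H by auto
    then show ?thesis by (simp add: chromatic_sym_def)
  next
    case True
    define rs where "rs = sorted_list_of_set (set_mset M - {i, j})"
    define r where "r = map (count M) rs"
    have rs: "distinct rs" "set rs = set_mset M - {i, j}" by (auto simp: rs_def)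
    \<comment> \<open>The transferred monomial contains \<open>j\<close> even if \<open>M\<close> does not, so \<open>j\<close> is listed with multiplicity possibly 0.\<close>
    let ?xs = "i # j # rs" and ?a = "count M i" and ?b = "count M j"
    have xs: "distinct ?xs" "set_mset M \<subseteq> set ?xs" "set_mset ?M' \<subseteq> set ?xs" "0 \<notin> set ?xs"
      using rs ij True by (auto dest: in_diffD)
    have sum: "?a + ?b + sum_list r = 6" using sum_list_counts[OF xs(1,2)] True by (simp add: r_def)
    have "0 \<notin> set r" unfolding r_def by (rule counts_nonzero) (use rs in auto)
    moreover have "sum_list r = 6 - ?a - ?b" using sum by simp
    ultimately have r: "r \<in> set (compositions (6 - ?a - ?b))" using mem_compositions by metis
    have pairs: "(a, b) \<in> set [(2,0), (3,0), (3,1), (4,0), (4,1), (4,2), (5,0), (5,1), (6,0)]"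
      if "b + 2 \<le> a" "a + b \<le> 6" for a b :: nat
    proof -
      have "b = 0 \<and> (a = 2 \<or> a = 3 \<or> a = 4 \<or> a = 5 \<or> a = 6) \<or> b = 1 \<and> (a = 3 \<or> a = 4 \<or> a = 5) \<or> b = 2 \<and> a = 4"
        using that by presburger
      then show ?thesis by auto
    qed
    have "(?a, ?b) \<in> set [(2,0), (3,0), (3,1), (4,0), (4,1), (4,2), (5,0), (5,1), (6,0)]"
      by (rule pairs) (use sum ge in auto)
    then have "chromH (?a # ?b # r) \<le> chromH ((?a - 1) # Suc ?b # r)"
      using chromH_transfer r unfolding list_all_iff transfer_at_def by fast
    moreover have "map (count M) ?xs = ?a # ?b # r" by (simp add: r_def)
    moreover have "map (count ?M') ?xs = (?a - 1) # Suc ?b # r"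
      using rs ij by (auto simp: r_def)
    ultimately show ?thesis
      unfolding chromatic_sym_H[OF xs(1,2,4)] chromatic_sym_H[OF xs(1,3,4)] by simp
  qed
qed

section \<open>The disjoint union with a complete graph\<close>

lemma not_connected_disjoint_union:
  assumes "u \<in> pverts G" "v \<in> pverts H"
  shows "\<not> connected (with_proj (G \<squnion>\<^sub>G H))"
proof
  let ?S = "with_proj (mk_symmetric (with_proj (G \<squnion>\<^sub>G H)))"
  assume "connected (with_proj (G \<squnion>\<^sub>G H))"
  moreover have "Inl u \<in> verts ?S" "Inr v \<in> verts ?S"
    using assms by (auto simp: mk_symmetric_def disjoint_union_def)
  ultimately have "Inl u \<rightarrow>\<^sup>*\<^bsub>?S\<^esub> Inr v"
    unfolding connected_def strongly_connected_def by blast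
  then have "(Inl u, Inr v) \<in> rtrancl_on (verts ?S) (arcs_ends ?S)" by (simp add: reachable_def)
  then have "Inr v \<in> range (Inl :: 'a \<Rightarrow> 'a + 'b)"
    by (induction rule: rtrancl_on_induct) (auto simp: mk_symmetric_def disjoint_union_def)
  then show False by auto
qed

lemma chromatic_sym_disjoint_complete:
  assumes G: "pair_graph G"
  shows "chromatic_sym (G \<squnion>\<^sub>G complete_graph t) M = fact t * e_mult t (chromatic_sym G) M"
proof -
  interpret pair_graph G by fact
  have "pair_graph (G \<squnion>\<^sub>G complete_graph t)"
    by (intro pair_graph_disjoint_union G pair_graphI_complete[OF complete_graph_correct])
  then have "chromatic_sym (G \<squnion>\<^sub>G complete_graph t) M =
      of_nat (fact t * e_mult t (\<lambda>N. card (colorings (pverts G) (parcs G) N)) M)"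
    using card_colorings_disjoint_complete[of "pverts G" t "parcs G" M]
    by (simp add: chromatic_sym_eq_card disjoint_union_def complete_graph_def)
  also have "\<dots> = fact t * e_mult t (chromatic_sym G) M"
    by (simp add: e_mult_def chromatic_sym_eq_card[OF G])
  finally show ?thesis .
qed

lemma chromatic_sym_M: "chromatic_sym (M_graph t) M = fact t * e_mult t (chromatic_sym K33_minus_edge) M"
  unfolding M_graph_def by (rule chromatic_sym_disjoint_complete[OF pair_graph_H])

lemma card_verts_M: "card (pverts (M_graph t)) = t + 6"
proof -
  have "pverts (M_graph t) = pverts K33_minus_edge <+> {..<t}"
    by (simp add: M_graph_def disjoint_union_def complete_graph_def)
  moreover have "finite (pverts K33_minus_edge)" by (simp add: pverts_H)
  ultimately show ?thesis by (simp add: card_Plus card_verts_H)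
qed

lemma strongly_nice_M: "strongly_nice (M_graph t)"
proof -
  let ?f = "chromatic_sym (M_graph t)"
  have "transfer_monotone (e_mult t (chromatic_sym K33_minus_edge))"
    by (rule transfer_monotone_e_mult[OF transfer_monotone_H symmetric_chromatic_sym[OF pair_graph_H]])
       (auto simp: chromatic_sym_eq_0[OF pair_graph_H], simp add: chromatic_sym_def)
  then have "transfer_monotone ?f" by (simp add: transfer_monotone_def chromatic_sym_M)
  moreover have "basis_coeff monomial_sym \<nu> ?f = ?f (canon \<nu>)" if "\<nu> \<in> partitions_of (t + 6)" for \<nu>
    by (rule basis_coeff_monomial[OF symmetric_chromatic_sym[OF pair_graph_M_graph] _ that])
       (auto simp: card_verts_M intro: chromatic_sym_eq_0[OF pair_graph_M_graph])
  ultimately show ?thesis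
    unfolding strongly_nice_def card_verts_M using transfer_monotone_canon by simp
qed

text \<open>
  The coefficient of $s_\nu$ in $e_t X_H$. The size \<open>t\<close> of the strips is determined by the size of \<open>\<nu>\<close>.
\<close>

definition M_weight :: "nat list \<Rightarrow> int" where
  "M_weight \<nu> = (\<Sum>(\<xi>, c)\<leftarrow>H_terms. c * of_bool (vertical \<xi> \<nu>))"

lemma e_mult_sum_list: "e_mult t (\<lambda>N. \<Sum>x\<leftarrow>xs. f x N) M = (\<Sum>x\<leftarrow>xs. e_mult t (f x) M)"
  by (induction xs) (simp_all add: e_mult_def sum.distrib)

lemma e_mult_scale: "e_mult t (\<lambda>N. c * f N) M = c * (e_mult t f M :: rat)"
  by (simp add: e_mult_def sum_distrib_left)

lemma sum_list_sum_swap: "(\<Sum>x\<leftarrow>xs. \<Sum>y\<in>A. g x y) = (\<Sum>y\<in>A. \<Sum>x\<leftarrow>xs. g x y :: 'a :: comm_monoid_add)"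
  by (induction xs) (simp_all add: sum.distrib)

lemma chromatic_sym_M_schur:
  "chromatic_sym (M_graph t) M = (\<Sum>\<nu>\<in>partitions_of (t + 6). fact t * of_int (M_weight \<nu>) * schur \<nu> M)"
proof (cases "0 \<in># M")
  case True
  then have "chromatic_sym (M_graph t) M = 0"
    using chromatic_sym_eq_0[OF pair_graph_M_graph] by blast
  moreover have "schur \<nu> M = 0" if "\<nu> \<in> partitions_of (t + 6)" for \<nu>
    using that True schur_eq_0 by (auto simp: partitions_of_def)
  ultimately show ?thesis by simp
next
  case False
  let ?P = "partitions_of (t + 6)"
  have pieri_term: "e_mult t (schur \<xi>) M = (\<Sum>\<nu>\<in>?P. of_bool (vertical \<xi> \<nu>) * schur \<nu> M)" if "(\<xi>, c) \<in> set H_terms" for \<xi> c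
  proof -
    have \<xi>: "is_partition \<xi>" "sum_list \<xi> = 6" using H_terms_partition[OF that] by auto
    have "e_mult t (schur \<xi>) M = (\<Sum>\<nu> | \<nu> \<in> ?P \<and> vertical \<xi> \<nu>. schur \<nu> M)"
      unfolding pieri_schur[OF \<xi>(1) False] by (simp add: \<xi>(2) add.commute)
    also have "\<dots> = (\<Sum>\<nu>\<in>?P. of_bool (vertical \<xi> \<nu>) * schur \<nu> M)"
      by (rule sum.mono_neutral_cong_left) (auto simp: finite_partitions_of)
    finally show ?thesis .
  qed
  have "e_mult t (chromatic_sym K33_minus_edge) M = e_mult t (\<lambda>N. \<Sum>(\<xi>, c)\<leftarrow>H_terms. of_int c * schur \<xi> N) M"
    by (rule e_mult_cong) (rule chromatic_sym_H_schur)
  also have "\<dots> = (\<Sum>(\<xi>, c)\<leftarrow>H_terms. of_int c * e_mult t (schur \<xi>) M)"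
    using e_mult_sum_list[of t "\<lambda>(\<xi>, c) N. of_int c * schur \<xi> N" H_terms M]
    by (simp add: split_def e_mult_scale)
  also have "\<dots> = (\<Sum>(\<xi>, c)\<leftarrow>H_terms. \<Sum>\<nu>\<in>?P. of_int c * of_bool (vertical \<xi> \<nu>) * schur \<nu> M)"
    by (intro arg_cong[where f = sum_list] map_cong refl) (auto simp: pieri_term sum_distrib_left mult.assoc)
  also have "\<dots> = (\<Sum>\<nu>\<in>?P. \<Sum>(\<xi>, c)\<leftarrow>H_terms. of_int c * of_bool (vertical \<xi> \<nu>) * schur \<nu> M)"
    by (simp add: split_def sum_list_sum_swap)
  also have "\<dots> = (\<Sum>\<nu>\<in>?P. of_int (M_weight \<nu>) * schur \<nu> M)"
    by (intro sum.cong refl) (simp add: M_weight_def H_terms_def algebra_simps)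
  finally show ?thesis
    by (simp add: chromatic_sym_M sum_distrib_left mult.assoc)
qed

lemma basis_coeff_schur_M:
  assumes "is_partition \<nu>"
  shows "basis_coeff schur \<nu> (chromatic_sym (M_graph t)) =
    (if \<nu> \<in> partitions_of (t + 6) then fact t * of_int (M_weight \<nu>) else 0)"
  by (rule basis_coeff_schur[where A = "partitions_of (t + 6)" and c = "\<lambda>\<nu>. fact t * of_int (M_weight \<nu>)"])
     (use assms in \<open>simp_all add: finite_partitions_of chromatic_sym_M_schur, auto simp: partitions_of_def\<close>)

lemma all_nat_split: "(\<forall>i. P i) \<longleftrightarrow> P 0 \<and> (\<forall>i. P (Suc i))"
  by (metis not0_implies_Suc)

lemma vertical_simps [simp]:
  "vertical [] []"
  "vertical [] (b # \<mu>) \<longleftrightarrow> b \<le> 1 \<and> vertical [] \<mu>"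
  "vertical (a # \<nu>) [] \<longleftrightarrow> a = 0 \<and> vertical \<nu> []"
  "vertical (a # \<nu>) (b # \<mu>) \<longleftrightarrow> a \<le> b \<and> b \<le> Suc a \<and> vertical \<nu> \<mu>"
  unfolding vertical_def by (simp, (subst all_nat_split, simp)+)

lemma vertical_column: "vertical [] (replicate n 1)"
  by (induction n) auto

lemma M_weight_333: "M_weight ([3, 3, 3] @ replicate n 1) = - 4"
  using vertical_column[of n] by (cases n) (auto simp: M_weight_def H_terms_def)

text \<open>
  Only $222$ contributes negatively. A shape of size 7 or 8 over $222$ has at most two cells more. If it has
  three rows, then these are $322$ or $332$, which arise from $321$. Otherwise its first three rows are
  followed by a row of length 1, the third row is still of length 2, and it arises from $2211$.
\<close>

lemma M_weight_nonneg:
  assumes \<nu>: "\<nu> \<in> partitions_of (t + 6)" and t: "1 \<le> t" "t \<le> 2"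
  shows "M_weight \<nu> \<ge> 0"
proof (cases "vertical [2,2,2] \<nu>")
  case False
  then show ?thesis by (simp add: M_weight_def H_terms_def)
next
  case True
  have "vertical [3,2,1] \<nu> \<or> vertical [2,2,1,1] \<nu>"
  proof -
    obtain a b c \<mu> where eq: "\<nu> = a # b # c # \<mu>"
      using True by (cases \<nu>; cases "tl \<nu>"; cases "tl (tl \<nu>)") auto
    have bounds: "a \<in> {2..3}" "b \<in> {2..3}" "c \<in> {2..3}" "vertical [] \<mu>" using True by (auto simp: eq)
    have sorted: "b \<le> a" "c \<le> b" and size: "a + b + c + sum_list \<mu> = t + 6" and 0: "0 \<notin> set \<mu>"
      using \<nu> by (auto simp: eq partitions_of_def is_partition_def)
    show ?thesis
    proof (cases \<mu>)
      case Nil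
      then show ?thesis using bounds sorted size t by (auto simp: eq)
    next
      case (Cons d \<mu>')
      then show ?thesis using bounds sorted size t 0 by (auto simp: eq)
    qed
  qed
  then show ?thesis by (auto simp: M_weight_def H_terms_def)
qed

theorem theorem1p3:
  fixes t :: nat
  assumes "t \<ge> 1"
  shows "\<not> connected (with_proj (M_graph t))
    \<and> strongly_nice (M_graph t)
    \<and> (schur_positive (M_graph t) \<longleftrightarrow> t = 1 \<or> t = 2)
    \<and> (t \<ge> 3 \<longrightarrow>
        basis_coeff schur ([3, 3, 3] @ replicate (t - 3) 1) (chromatic_sym (M_graph t)) = - 4 * fact t
        \<and> - 4 * fact t < (0 :: rat))"
proof -
  have "\<not> connected (with_proj (M_graph t))"
    unfolding M_graph_def
    by (rule not_connected_disjoint_union[where u = "Inl 0" and v = 0])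
       (use assms in \<open>auto simp: pverts_H vertsH_def complete_graph_def\<close>)
  moreover have coeff: "basis_coeff schur ([3, 3, 3] @ replicate (t - 3) 1) (chromatic_sym (M_graph t)) = - 4 * fact t"
    and part: "is_partition ([3, 3, 3] @ replicate (t - 3) 1)" if "t \<ge> 3"
  proof -
    show part: "is_partition ([3, 3, 3] @ replicate (t - 3) 1)"
      by (auto simp: is_partition_def sorted_wrt_append sorted_wrt_iff_nth_less[of _ "replicate _ _"])
    then have "[3, 3, 3] @ replicate (t - 3) 1 \<in> partitions_of (t + 6)"
      using that by (simp add: partitions_of_def sum_list_replicate)
    then show "basis_coeff schur ([3, 3, 3] @ replicate (t - 3) 1) (chromatic_sym (M_graph t)) = - 4 * fact t"
      unfolding basis_coeff_schur_M[OF part] M_weight_333 by simp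
  qed
  moreover have neg: "- 4 * fact t < (0 :: rat)" by simp
  moreover have "schur_positive (M_graph t) \<longleftrightarrow> t = 1 \<or> t = 2"
  proof
    assume pos: "schur_positive (M_graph t)"
    show "t = 1 \<or> t = 2"
    proof (rule ccontr)
      assume "\<not> (t = 1 \<or> t = 2)"
      then have "t \<ge> 3" using assms by linarith
      then have "- 4 * fact t \<ge> (0 :: rat)" using pos coeff part unfolding schur_positive_def by metis
      then show False using neg by linarith
    qed
  next
    assume "t = 1 \<or> t = 2"
    then have "t \<le> 2" by auto
    then have "M_weight \<nu> \<ge> 0" if "\<nu> \<in> partitions_of (t + 6)" for \<nu>
      using M_weight_nonneg[OF that assms] by simp
    then show "schur_positive (M_graph t)"
      unfolding schur_positive_def by (auto simp: basis_coeff_schur_M)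
  qed
  ultimately show ?thesis using strongly_nice_M by blast
qed

end
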